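(* Let $n$ be a positive integer, let $(\lambda_1,\ldots,\lambda_n)\in(0,+\infty)^n$, let $R>0$ be a real number, and let $$t_0:=\frac{\pi}{2}\sum_{k=1}^n\frac{1}{\lambda_k}.$$ Then there exists a $t_0$-periodic function $\delta:[0,+\infty)\to[0,+\infty)$ such that every solution $(u_1(t),\ldots,u_n(t))$ (with each $u_k:[0,+\infty)\to\mathbb{R}$) to the system $$u_k''(t)+2\delta(t)u_k'(t)+\lambda_k^2u_k(t)=0,\qquad k=1,\ldots,n,$$ satisfies $$\sum_{k=1}^n\left(|u_k'(t)|^2+\lambda_k^2|u_k(t)|^2\right)\le\left[\sum_{k=1}^n\left(|u_k'(0)|^2+\lambda_k^2|u_k(0)|^2\right)\right]\exp\left(-R\,(t-t_0)^+\right)$$ for every $t\ge 0$. Moreover, $\delta$ can be chosen of class $C^\infty$, and it can alternatively be chosen piecewise constant (i.e. there exist both a $C^\infty$ function $\delta:[0,+\infty)\to[0,+\infty)$ and a piecewise constant function $\delta:[0,+\infty)\to[0,+\infty)$, each of which is $t_0$-periodic and such that every solution $(u_1,\ldots,u_n)$ to the system $u_k''(t)+2\delta(t)u_k'(t)+\lambda_k^2u_k(t)=0$, $k=1,\ldots,n$, satisfies $\sum_{k=1}^n\left(|u_k'(t)|^2+\lambda_k^2|u_k(t)|^2\right)\le\left[\sum_{k=1}^n\left(|u_k'(0)|^2+\lambda_k^2|u_k(0)|^2\right)\right]\exp\left(-R\,(t-t_0)^+\right)$ for every $t\ge 0$).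
   Context: $(x)^+:=\max\{x,0\}$. Piecewise constant means having finitely many constancy intervals on each bounded interval. When $\delta$ is not continuous, a solution is a tuple of functions $u_k\in C^1([0,+\infty))$ with $u_k'$ locally absolutely continuous that satisfies the equations for almost every $t$. *)

theory Defs
  imports "HOL-Analysis.Analysis"
begin

text \<open>
  Functions on \<open>[0,+\<infinity>)\<close> are represented by total functions on the reals, and only their values
  on \<open>{0..}\<close> are ever used; in particular the derivative at \<open>0\<close> is one-sided.
\<close>

definition half_line_deriv :: "(real \<Rightarrow> real) \<Rightarrow> real \<Rightarrow> real" where
  "half_line_deriv f t = vector_derivative f (at t within {0..})"

definition C1_half_line :: "(real \<Rightarrow> real) \<Rightarrow> bool" where
  "C1_half_line f \<longleftrightarrow> f differentiable_on {0..} \<and> continuous_on {0..} (half_line_deriv f)"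

text \<open>Continuity of the iterated derivatives follows from differentiability at the next order.\<close>

definition smooth_half_line :: "(real \<Rightarrow> real) \<Rightarrow> bool" where
  "smooth_half_line f \<longleftrightarrow> (\<forall>m. (half_line_deriv ^^ m) f differentiable_on {0..})"

definition abs_continuous_on_Icc :: "real \<Rightarrow> real \<Rightarrow> (real \<Rightarrow> real) \<Rightarrow> bool" where
  "abs_continuous_on_Icc a b f \<longleftrightarrow>
     (\<forall>\<epsilon>>0. \<exists>\<eta>>0. \<forall>P :: (real \<times> real) set.
        finite P \<and> (\<forall>(x, y)\<in>P. a \<le> x \<and> x \<le> y \<and> y \<le> b) \<and>
        pairwise (\<lambda>p q. disjnt {fst p<..<snd p} {fst q<..<snd q}) P \<and>
        (\<Sum>(x, y)\<in>P. y - x) < \<eta>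
        \<longrightarrow> (\<Sum>(x, y)\<in>P. \<bar>f y - f x\<bar>) < \<epsilon>)"

definition loc_abs_continuous_half_line :: "(real \<Rightarrow> real) \<Rightarrow> bool" where
  "loc_abs_continuous_half_line f \<longleftrightarrow> (\<forall>a b. 0 \<le> a \<and> a \<le> b \<longrightarrow> abs_continuous_on_Icc a b f)"

definition piecewise_constant_half_line :: "(real \<Rightarrow> real) \<Rightarrow> bool" where
  "piecewise_constant_half_line f \<longleftrightarrow>
     (\<forall>I. is_interval I \<and> bounded I \<and> I \<subseteq> {0..} \<longrightarrow>
        (\<exists>P. finite P \<and> partition_on I P \<and> (\<forall>J\<in>P. is_interval J \<and> f constant_on J)))"

text \<open>
  The equation \<open>u'' + 2 \<delta> u' + l\<^sup>2 u = 0\<close> holds at \<open>t\<close>; this includes the existence of \<open>u'' t\<close>.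
\<close>

definition damped_eq_at :: "(real \<Rightarrow> real) \<Rightarrow> real \<Rightarrow> (real \<Rightarrow> real) \<Rightarrow> real \<Rightarrow> bool" where
  "damped_eq_at \<delta> l u t \<longleftrightarrow>
     half_line_deriv u differentiable (at t within {0..}) \<and>
     half_line_deriv (half_line_deriv u) t + 2 * \<delta> t * half_line_deriv u t + l\<^sup>2 * u t = 0"

text \<open>
  For continuous \<open>\<delta>\<close> solutions are meant in the classical sense; otherwise \<open>u'\<close> is locally
  absolutely continuous and the equation holds almost everywhere.
\<close>

definition damped_solution :: "(real \<Rightarrow> real) \<Rightarrow> real \<Rightarrow> (real \<Rightarrow> real) \<Rightarrow> bool" where
  "damped_solution \<delta> l u \<longleftrightarrow>
     C1_half_line u \<and>
     (if continuous_on {0..} \<delta> then \<forall>t\<ge>0. damped_eq_at \<delta> l u t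
      else loc_abs_continuous_half_line (half_line_deriv u) \<and>
           (AE t in lebesgue. 0 \<le> t \<longrightarrow> damped_eq_at \<delta> l u t))"

definition damped_system_solution ::
  "nat \<Rightarrow> (nat \<Rightarrow> real) \<Rightarrow> (real \<Rightarrow> real) \<Rightarrow> (nat \<Rightarrow> real \<Rightarrow> real) \<Rightarrow> bool" where
  "damped_system_solution n lam \<delta> u \<longleftrightarrow> (\<forall>k\<in>{1..n}. damped_solution \<delta> (lam k) (u k))"

definition energy :: "nat \<Rightarrow> (nat \<Rightarrow> real) \<Rightarrow> (nat \<Rightarrow> real \<Rightarrow> real) \<Rightarrow> real \<Rightarrow> real" where
  "energy n lam u t =
     (\<Sum>k=1..n. \<bar>half_line_deriv (u k) t\<bar>\<^sup>2 + (lam k)\<^sup>2 * \<bar>u k t\<bar>\<^sup>2)"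

definition admissible_damping ::
  "nat \<Rightarrow> (nat \<Rightarrow> real) \<Rightarrow> real \<Rightarrow> real \<Rightarrow> (real \<Rightarrow> real) \<Rightarrow> bool" where
  "admissible_damping n lam R t0 \<delta> \<longleftrightarrow>
     (\<forall>t\<ge>0. 0 \<le> \<delta> t) \<and> (\<forall>t\<ge>0. \<delta> (t + t0) = \<delta> t) \<and>
     (\<forall>u. damped_system_solution n lam \<delta> u \<longrightarrow>
        (\<forall>t\<ge>0. energy n lam u t \<le> energy n lam u 0 * exp (- R * max (t - t0) 0)))"

end

theory Submission
  imports Defs
begin

text \<open>
  A very strong and very short damping pulse annihilates the velocities of all components and hardly
  changes their positions. Divide a period into slots of length \<open>\<pi> / (2 \<lambda>\<^sub>k)\<close>, \<open>k = 1, \<dots>, n\<close>, with a pulse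
  at every end point and no damping in between. In the \<open>k\<close>-th slot the \<open>k\<close>-th component starts almost at
  rest and moves freely for a quarter of its own period, so that its energy is almost purely kinetic
  when the next pulse destroys it. As energies never increase, after one period every component has
  lost all but an arbitrarily small fraction of its energy, in particular all but the fraction
  \<open>exp (- R t\<^sub>0)\<close>, and the estimate follows by iteration over the periods.
\<close>

section \<open>Absolutely continuous functions\<close>

text \<open>For discontinuous \<delta> the equation holds only almost everywhere, and during a pulse
  no solution formula is at hand. The energy and velocity estimates therefore each exhibit a
  function that is nonincreasing along the solution, which needs only absolute continuity and a
  signed derivative off a null set. This covers both notions of solution at once and speaks about
  every solution without any existence theory. The slots fill a period exactly, so the pulses have
  to be carved out of the quarter periods. A pulse of half-width \<open>h\<close> around each end
  point shortens the free phase by \<open>2 * l * h\<close>, and damping of strength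
  \<open>K\<close> leaves a squared velocity of relative size about
  \<open>exp (- 4 * K * h / 3) + l / (4 * K)\<close>. All errors vanish together when
  \<open>h\<close> tends to 0 while \<open>K\<close> and \<open>K * h\<close> tend to infinity;
  \<open>K = 1 / h\<^sup>2\<close> is such a choice. Strong damping is required only up to distance
  \<open>h / 3\<close> from an end point and silence only beyond distance \<open>h\<close>. The zone
  in between is free apart from nonnegativity, which leaves room for a smooth as well as for a
  discontinuous transition.\<close>

lemma abs_continuous_on_Icc_lipschitz:
  assumes "\<And>x y. a \<le> x \<Longrightarrow> x \<le> y \<Longrightarrow> y \<le> b \<Longrightarrow> \<bar>f y - f x\<bar> \<le> C * (y - x)"
  shows "abs_continuous_on_Icc a b f"
  unfolding abs_continuous_on_Icc_def
proof (intro allI impI)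
  fix \<epsilon> :: real assume "\<epsilon> > 0"
  define \<eta> where "\<eta> = \<epsilon> / (\<bar>C\<bar> + 1)"
  have "\<eta> > 0" using \<open>\<epsilon> > 0\<close> by (simp add: \<eta>_def add_nonneg_pos)
  have "(\<Sum>(x, y)\<in>P. \<bar>f y - f x\<bar>) < \<epsilon>"
    if P: "finite P \<and> (\<forall>(x, y)\<in>P. a \<le> x \<and> x \<le> y \<and> y \<le> b) \<and>
        pairwise (\<lambda>p q. disjnt {fst p<..<snd p} {fst q<..<snd q}) P \<and>
        (\<Sum>(x, y)\<in>P. y - x) < \<eta>" for P
  proof -
    have "(\<Sum>(x, y)\<in>P. \<bar>f y - f x\<bar>) \<le> (\<Sum>(x, y)\<in>P. (\<bar>C\<bar> + 1) * (y - x))"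
    proof (rule sum_mono, clarsimp)
      fix x y assume "(x, y) \<in> P"
      then have xy: "a \<le> x" "x \<le> y" "y \<le> b" using P by auto
      have "C * (y - x) \<le> (\<bar>C\<bar> + 1) * (y - x)" using xy by (intro mult_right_mono) auto
      then show "\<bar>f y - f x\<bar> \<le> (\<bar>C\<bar> + 1) * (y - x)" using assms[OF xy] by linarith
    qed
    also have "\<dots> = (\<bar>C\<bar> + 1) * (\<Sum>(x, y)\<in>P. y - x)"
      by (simp add: sum_distrib_left split_beta)
    also have "\<dots> < (\<bar>C\<bar> + 1) * \<eta>" using P by (intro mult_strict_left_mono) auto
    also have "\<dots> = \<epsilon>" by (simp add: \<eta>_def)
    finally show ?thesis .
  qed
  with \<open>\<eta> > 0\<close> show "\<exists>\<eta>>0. \<forall>P. finite P \<and> (\<forall>(x, y)\<in>P. a \<le> x \<and> x \<le> y \<and> y \<le> b) \<and>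
        pairwise (\<lambda>p q. disjnt {fst p<..<snd p} {fst q<..<snd q}) P \<and>
        (\<Sum>(x, y)\<in>P. y - x) < \<eta> \<longrightarrow> (\<Sum>(x, y)\<in>P. \<bar>f y - f x\<bar>) < \<epsilon>" by blast
qed

lemma abs_continuous_on_Icc_const: "abs_continuous_on_Icc a b (\<lambda>x. c)"
  by (rule abs_continuous_on_Icc_lipschitz[of _ _ _ 0]) auto

text \<open>Common source of closure under sums and products: a single bound on increments lets
  \<open>h\<close> inherit the moduli of \<open>f\<close> and \<open>g\<close>.\<close>

lemma abs_continuous_on_Icc_dominated:
  assumes f: "abs_continuous_on_Icc a b f" and g: "abs_continuous_on_Icc a b g"
    and le: "\<And>x y. a \<le> x \<Longrightarrow> x \<le> y \<Longrightarrow> y \<le> b \<Longrightarrow>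
      \<bar>h y - h x\<bar> \<le> C * (\<bar>f y - f x\<bar> + \<bar>g y - g x\<bar>)"
  shows "abs_continuous_on_Icc a b h"
  unfolding abs_continuous_on_Icc_def
proof (intro allI impI)
  fix \<epsilon> :: real assume "\<epsilon> > 0"
  define e where "e = \<epsilon> / (2 * (\<bar>C\<bar> + 1))"
  have "e > 0" using \<open>\<epsilon> > 0\<close> by (simp add: e_def add_nonneg_pos)
  let ?Q = "\<lambda>P \<eta>. finite P \<and> (\<forall>(x, y)\<in>P. a \<le> x \<and> x \<le> y \<and> y \<le> b) \<and>
        pairwise (\<lambda>p q. disjnt {fst p<..<snd p} {fst q<..<snd q}) P \<and>
        (\<Sum>(x, y)\<in>P. y - x) < (\<eta>::real)"
  obtain \<eta>1 where \<eta>1: "\<eta>1 > 0" "\<And>P. ?Q P \<eta>1 \<Longrightarrow> (\<Sum>(x, y)\<in>P. \<bar>f y - f x\<bar>) < e"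
    using f[unfolded abs_continuous_on_Icc_def, rule_format, OF \<open>e > 0\<close>] by blast
  obtain \<eta>2 where \<eta>2: "\<eta>2 > 0" "\<And>P. ?Q P \<eta>2 \<Longrightarrow> (\<Sum>(x, y)\<in>P. \<bar>g y - g x\<bar>) < e"
    using g[unfolded abs_continuous_on_Icc_def, rule_format, OF \<open>e > 0\<close>] by blast
  have "(\<Sum>(x, y)\<in>P. \<bar>h y - h x\<bar>) < \<epsilon>" if P: "?Q P (min \<eta>1 \<eta>2)" for P
  proof -
    have "(\<Sum>(x, y)\<in>P. \<bar>h y - h x\<bar>) \<le> (\<Sum>(x, y)\<in>P. (\<bar>C\<bar> + 1) * (\<bar>f y - f x\<bar> + \<bar>g y - g x\<bar>))"
    proof (rule sum_mono, clarsimp)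
      fix x y assume "(x, y) \<in> P"
      then have xy: "a \<le> x" "x \<le> y" "y \<le> b" using P by auto
      have "C * (\<bar>f y - f x\<bar> + \<bar>g y - g x\<bar>) \<le> (\<bar>C\<bar> + 1) * (\<bar>f y - f x\<bar> + \<bar>g y - g x\<bar>)"
        by (intro mult_right_mono) auto
      then show "\<bar>h y - h x\<bar> \<le> (\<bar>C\<bar> + 1) * (\<bar>f y - f x\<bar> + \<bar>g y - g x\<bar>)"
        using le[OF xy] by linarith
    qed
    also have "\<dots> = (\<bar>C\<bar> + 1) * ((\<Sum>(x, y)\<in>P. \<bar>f y - f x\<bar>) + (\<Sum>(x, y)\<in>P. \<bar>g y - g x\<bar>))"
      by (simp add: sum_distrib_left sum.distrib distrib_left split_beta)
    also have "\<dots> < (\<bar>C\<bar> + 1) * (e + e)"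
      using P by (intro mult_strict_left_mono add_strict_mono \<eta>1 \<eta>2) auto
    also have "\<dots> = \<epsilon>" unfolding e_def by (simp add: divide_simps)
    finally show ?thesis .
  qed
  moreover have "min \<eta>1 \<eta>2 > 0" using \<eta>1 \<eta>2 by simp
  ultimately show "\<exists>\<eta>>0. \<forall>P. ?Q P \<eta> \<longrightarrow> (\<Sum>(x, y)\<in>P. \<bar>h y - h x\<bar>) < \<epsilon>" by blast
qed

lemma abs_continuous_on_Icc_add:
  assumes "abs_continuous_on_Icc a b f" "abs_continuous_on_Icc a b g"
  shows "abs_continuous_on_Icc a b (\<lambda>x. f x + g x)"
  by (rule abs_continuous_on_Icc_dominated[OF assms, of _ 1]) auto

lemma abs_continuous_on_Icc_mult:
  fixes f g :: "real \<Rightarrow> real"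
  assumes "abs_continuous_on_Icc a b f" "abs_continuous_on_Icc a b g"
    and cont: "continuous_on {a..b} f" "continuous_on {a..b} g"
  shows "abs_continuous_on_Icc a b (\<lambda>x. f x * g x)"
proof -
  have "bounded (f ` {a..b})" "bounded (g ` {a..b})"
    using cont by (auto intro!: compact_imp_bounded compact_continuous_image)
  then obtain A B where A: "\<And>x. x \<in> {a..b} \<Longrightarrow> \<bar>f x\<bar> \<le> A" and B: "\<And>x. x \<in> {a..b} \<Longrightarrow> \<bar>g x\<bar> \<le> B"
    unfolding bounded_iff by (metis imageI real_norm_def)
  show ?thesis
  proof (rule abs_continuous_on_Icc_dominated[OF assms(1,2), of _ "max A B"])
    fix x y assume xy: "a \<le> x" "x \<le> y" "y \<le> b"
    have "\<bar>f y * g y - f x * g x\<bar> = \<bar>g y * (f y - f x) + f x * (g y - g x)\<bar>"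
      by (simp add: algebra_simps)
    also have "\<dots> \<le> \<bar>g y\<bar> * \<bar>f y - f x\<bar> + \<bar>f x\<bar> * \<bar>g y - g x\<bar>"
      by (metis abs_mult abs_triangle_ineq)
    also have "\<dots> \<le> max A B * \<bar>f y - f x\<bar> + max A B * \<bar>g y - g x\<bar>"
      using A[of x] B[of y] xy by (intro add_mono mult_right_mono) auto
    finally show "\<bar>f y * g y - f x * g x\<bar> \<le> max A B * (\<bar>f y - f x\<bar> + \<bar>g y - g x\<bar>)"
      by (simp add: distrib_left)
  qed
qed

lemma abs_continuous_on_Icc_C1:
  assumes f: "\<And>x. x \<in> {a..b} \<Longrightarrow> (f has_real_derivative f' x) (at x within {a..b})"
    and cont: "continuous_on {a..b} f'"
  shows "abs_continuous_on_Icc a b f"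
proof -
  have "bounded (f' ` {a..b})"
    using cont by (auto intro!: compact_imp_bounded compact_continuous_image)
  then obtain C where C: "\<And>x. x \<in> {a..b} \<Longrightarrow> norm (f' x) \<le> C"
    unfolding bounded_iff by (metis imageI)
  show ?thesis
  proof (rule abs_continuous_on_Icc_lipschitz)
    fix x y assume xy: "a \<le> x" "x \<le> y" "y \<le> b"
    have "norm (f y - f x) \<le> C * norm (y - x)"
      by (rule field_differentiable_bound[where S = "{a..b}" and f' = f'])
        (use xy f C in auto)
    then show "\<bar>f y - f x\<bar> \<le> C * (y - x)" using xy by simp
  qed
qed

text \<open>
  A fine tagged division splits into the pieces tagged outside \<open>N\<close>, where the derivative controls
  the increment, and those tagged in \<open>N\<close>, whose total length is small because the indicator of
  \<open>N\<close> has gauge integral 0.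
\<close>

lemma abs_continuous_on_Icc_nonincreasing:
  fixes f :: "real \<Rightarrow> real"
  assumes "a \<le> b" and ac: "abs_continuous_on_Icc a b f" and N: "negligible N"
    and deriv: "\<And>t. t \<in> {a..b} - N \<Longrightarrow> \<exists>D\<le>0. (f has_real_derivative D) (at t within {a..b})"
  shows "f b \<le> f a"
proof (rule field_le_epsilon)
  fix e :: real assume "e > 0"
  \<comment> \<open>The pieces tagged in \<open>N\<close> will cost \<open>\<epsilon>\<close> and
    the remaining ones \<open>\<epsilon> * (b - a)\<close>.\<close>
  define \<epsilon> where "\<epsilon> = e / (b - a + 1)"
  have "\<epsilon> > 0" using \<open>e > 0\<close> \<open>a \<le> b\<close> by (simp add: \<epsilon>_def)
  obtain \<eta> where "\<eta> > 0" and \<eta>: "\<And>P. finite P \<Longrightarrow> (\<forall>(x, y)\<in>P. a \<le> x \<and> x \<le> y \<and> y \<le> b) \<Longrightarrow>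
        pairwise (\<lambda>p q. disjnt {fst p<..<snd p} {fst q<..<snd q}) P \<Longrightarrow>
        (\<Sum>(x, y)\<in>P. y - x) < \<eta> \<Longrightarrow> (\<Sum>(x, y)\<in>P. \<bar>f y - f x\<bar>) < \<epsilon>"
    using ac[unfolded abs_continuous_on_Icc_def, rule_format, OF \<open>\<epsilon> > 0\<close>] by blast
  have "(indicat_real N has_integral 0) (cbox a b)" using N by (simp add: negligible_def)
  then obtain \<gamma>1 where "gauge \<gamma>1" and \<gamma>1: "\<And>p. p tagged_division_of cbox a b \<Longrightarrow> \<gamma>1 fine p \<Longrightarrow>
      norm ((\<Sum>(x, K)\<in>p. measure lborel K *\<^sub>R indicat_real N x) - 0) < \<eta>"
    using has_integralD[OF _ \<open>\<eta> > 0\<close>] by metis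
  \<comment> \<open>An interval that straddles its tag is split at the tag; the errors of the two
    linear approximations add up to \<open>\<epsilon> * (y - x)\<close>, and the linear part is
    nonpositive.\<close>
  have "\<exists>d>0. \<forall>x y. a \<le> x \<longrightarrow> x \<le> t \<longrightarrow> t \<le> y \<longrightarrow> y \<le> b \<longrightarrow> x \<in> ball t d \<longrightarrow> y \<in> ball t d
      \<longrightarrow> f y - f x \<le> \<epsilon> * (y - x)" if "t \<in> {a..b} - N" for t
  proof -
    obtain D where "D \<le> 0" and D: "(f has_derivative (*) D) (at t within {a..b})"
      using deriv[OF \<open>t \<in> {a..b} - N\<close>] by (auto simp: has_field_derivative_def)
    obtain d where "d > 0" and d: "\<And>y. y \<in> {a..b} \<Longrightarrow> norm (y - t) < d \<Longrightarrow>
        norm (f y - f t - D * (y - t)) \<le> \<epsilon> * norm (y - t)"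
      using D \<open>\<epsilon> > 0\<close> unfolding has_derivative_within_alt by blast
    have "f y - f x \<le> \<epsilon> * (y - x)"
      if xy: "a \<le> x" "x \<le> t" "t \<le> y" "y \<le> b" "x \<in> ball t d" "y \<in> ball t d" for x y
    proof -
      have "\<bar>f y - f t - D * (y - t)\<bar> \<le> \<epsilon> * (y - t)" "\<bar>f x - f t - D * (x - t)\<bar> \<le> \<epsilon> * (t - x)"
        using d[of y] d[of x] xy by (auto simp: dist_real_def)
      then have "f y - f x \<le> D * (y - x) + \<epsilon> * (y - x)"
        by (simp add: algebra_simps abs_le_iff)
      moreover have "D * (y - x) \<le> 0" using \<open>D \<le> 0\<close> xy by (simp add: mult_le_0_iff)
      ultimately show ?thesis by linarith
    qed
    then show ?thesis using \<open>d > 0\<close> by blast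
  qed
  then obtain d where d0: "\<And>t. t \<in> {a..b} - N \<Longrightarrow> d t > 0" and
    d: "\<And>t x y. t \<in> {a..b} - N \<Longrightarrow> a \<le> x \<Longrightarrow> x \<le> t \<Longrightarrow> t \<le> y \<Longrightarrow> y \<le> b \<Longrightarrow> x \<in> ball t (d t) \<Longrightarrow>
        y \<in> ball t (d t) \<Longrightarrow> f y - f x \<le> \<epsilon> * (y - x)"
    by metis
  define \<gamma>2 where "\<gamma>2 t = (if t \<in> {a..b} - N then ball t (d t) else UNIV)" for t
  have "gauge \<gamma>2" using d0 by (auto simp: gauge_def \<gamma>2_def)
  then have "gauge (\<lambda>x. \<gamma>1 x \<inter> \<gamma>2 x)" using \<open>gauge \<gamma>1\<close> by (rule gauge_Int[rotated])
  then obtain p where p: "p tagged_division_of {a..b}" and "(\<lambda>x. \<gamma>1 x \<inter> \<gamma>2 x) fine p"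
    using fine_division_exists_real by blast
  then have fine1: "\<gamma>1 fine p" and fine2: "\<gamma>2 fine p" by (auto simp: fine_Int)
  have fin: "finite p" using p by blast
  define q where "q = {(x, K) \<in> p. x \<in> N}"
  have "q \<subseteq> p" by (auto simp: q_def)
  have intv: "\<exists>c d. K = {c..d} \<and> a \<le> c \<and> c \<le> x \<and> x \<le> d \<and> d \<le> b" if xK: "(x, K) \<in> p" for x K
  proof -
    obtain c d where "K = cbox c d" using tagged_division_ofD(4)[OF p xK] by blast
    moreover have "x \<in> K" "K \<subseteq> {a..b}" using tagged_division_ofD(2,3)[OF p xK] by auto
    ultimately show ?thesis by (intro exI[of _ c] exI[of _ d]) auto
  qed
  let ?inc = "\<lambda>K. f (Sup K) - f (Inf K)"
  have "f b - f a = (\<Sum>(x, K)\<in>p. ?inc K)"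
    using additive_tagged_division_1[OF \<open>a \<le> b\<close> p, of f] by simp
  also have "\<dots> = (\<Sum>(x, K)\<in>q. ?inc K) + (\<Sum>(x, K)\<in>p - q. ?inc K)"
    using fin \<open>q \<subseteq> p\<close> by (simp add: sum.subset_diff add.commute)
  also have "(\<Sum>(x, K)\<in>p - q. ?inc K) \<le> (\<Sum>(x, K)\<in>p - q. \<epsilon> * measure lborel K)"
  proof (rule sum_mono, clarify)
    fix x K assume xK: "(x, K) \<in> p" "(x, K) \<notin> q"
    obtain c1 c2 where c: "K = {c1..c2}" "a \<le> c1" "c1 \<le> x" "x \<le> c2" "c2 \<le> b" using intv xK by blast
    have xN: "x \<in> {a..b} - N" using xK c by (auto simp: q_def)
    have "K \<subseteq> ball x (d x)" using fineD[OF fine2 xK(1)] xN by (simp add: \<gamma>2_def)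
    moreover have "c1 \<in> K" "c2 \<in> K" using c by auto
    ultimately have "c1 \<in> ball x (d x)" "c2 \<in> ball x (d x)" by blast+
    then show "?inc K \<le> \<epsilon> * measure lborel K" using d[OF xN c(2-5)] c by simp
  qed
  also have "\<dots> \<le> (\<Sum>(x, K)\<in>p. \<epsilon> * measure lborel K)"
    using fin \<open>\<epsilon> > 0\<close> by (intro sum_mono2) auto
  also have "\<dots> = \<epsilon> * (\<Sum>(x, K)\<in>p. measure lborel K)" by (simp add: sum_distrib_left split_beta)
  also have "(\<Sum>(x, K)\<in>p. measure lborel K) = b - a"
    using additive_content_tagged_division[of p a b] p \<open>a \<le> b\<close> by simp
  also have "(\<Sum>(x, K)\<in>q. ?inc K) \<le> \<epsilon>"
  proof -
    have q: "q tagged_division_of \<Union>(snd ` q)"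
      using tagged_partial_division_of_Union_self[OF tagged_partial_division_subset[OF _ \<open>q \<subseteq> p\<close>]] p
      by (auto simp: tagged_division_of_def)
    have div: "snd ` q division_of \<Union>(snd ` q)" by (rule division_of_tagged_division[OF q])
    have rep: "\<exists>c d. K = {c..d} \<and> a \<le> c \<and> c \<le> d \<and> d \<le> b" if K: "K \<in> snd ` q" for K
    proof -
      obtain x where "(x, K) \<in> p" using K \<open>q \<subseteq> p\<close> by auto
      with intv[OF this] show ?thesis by (metis order_trans)
    qed
    \<comment> \<open>Absolute continuity is phrased for pairs of end points. The intervals are
      nonempty and closed, so passing to pairs loses nothing.\<close>
    define g where "g K = (Inf K, Sup K)" for K :: "real set"
    have inj: "inj_on g (snd ` q)"
    proof (rule inj_onI)
      fix K K' assume "K \<in> snd ` q" "K' \<in> snd ` q" "g K = g K'"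
      then show "K = K'" using rep[of K] rep[of K'] by (auto simp: g_def)
    qed
    have fq: "finite (snd ` q)" using fin \<open>q \<subseteq> p\<close> finite_subset by blast
    have "(\<Sum>(x, y)\<in>g ` snd ` q. \<bar>f y - f x\<bar>) < \<epsilon>"
    proof (rule \<eta>)
      show "finite (g ` snd ` q)" using fq by blast
      show "\<forall>(x, y)\<in>g ` snd ` q. a \<le> x \<and> x \<le> y \<and> y \<le> b"
      proof
        fix r assume "r \<in> g ` snd ` q"
        then obtain K where "r = g K" and K: "K \<in> snd ` q" by blast
        with rep[OF K] show "case r of (x, y) \<Rightarrow> a \<le> x \<and> x \<le> y \<and> y \<le> b" by (auto simp: g_def)
      qed
      show "pairwise (\<lambda>p q. disjnt {fst p<..<snd p} {fst q<..<snd q}) (g ` snd ` q)"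
      proof (rule pairwiseI)
        fix r s assume "r \<in> g ` snd ` q" "s \<in> g ` snd ` q" "r \<noteq> s"
        then obtain K K' where K: "K \<in> snd ` q" "K' \<in> snd ` q" "K \<noteq> K'" "r = g K" "s = g K'"
          by (metis imageE)
        have "interior K \<inter> interior K' = {}" by (rule division_ofD(5)[OF div K(1-3)])
        moreover obtain c d c' d' where "K = {c..d}" "c \<le> d" "K' = {c'..d'}" "c' \<le> d'"
          using rep[OF K(1)] rep[OF K(2)] by blast
        ultimately show "disjnt {fst r<..<snd r} {fst s<..<snd s}"
          using K(4,5) by (simp add: g_def disjnt_def)
      qed
      have "(\<Sum>(x, y)\<in>g ` snd ` q. y - x) = (\<Sum>K\<in>snd ` q. Sup K - Inf K)"
        by (subst sum.reindex[OF inj]) (simp add: g_def)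
      also have "\<dots> = (\<Sum>K\<in>snd ` q. measure lborel K)"
      proof (rule sum.cong[OF refl])
        fix K assume K: "K \<in> snd ` q"
        show "Sup K - Inf K = measure lborel K" using rep[OF K] by auto
      qed
      also have "\<dots> = (\<Sum>(x, K)\<in>q. measure lborel K)"
        by (rule sum.over_tagged_division_lemma[OF q, symmetric])
          (auto simp: content_eq_0_interior)
      \<comment> \<open>Every tag in \<open>q\<close> lies in \<open>N\<close>, so the total length
        is a Riemann sum of the indicator of \<open>N\<close>, which \<open>\<gamma>1\<close> makes
        small.\<close>
      also have "\<dots> = (\<Sum>(x, K)\<in>q. measure lborel K *\<^sub>R indicat_real N x)"
        by (rule sum.cong) (auto simp: q_def)
      also have "\<dots> = (\<Sum>(x, K)\<in>p. measure lborel K *\<^sub>R indicat_real N x)"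
        using fin \<open>q \<subseteq> p\<close> by (intro sum.mono_neutral_left) (auto simp: q_def indicator_def)
      also have "\<dots> < \<eta>" using \<gamma>1[OF _ fine1] p by simp
      finally show "(\<Sum>(x, y)\<in>g ` snd ` q. y - x) < \<eta>" .
    qed
    also have "(\<Sum>(x, y)\<in>g ` snd ` q. \<bar>f y - f x\<bar>) = (\<Sum>K\<in>snd ` q. \<bar>f (Sup K) - f (Inf K)\<bar>)"
      by (subst sum.reindex[OF inj]) (simp add: g_def)
    \<comment> \<open>Degenerate intervals may carry several tags, so the passage between intervals
      and tagged pieces needs a summand that vanishes on every interval with empty interior. The
      guard secures this for the empty set, where \<open>Inf\<close> and \<open>Sup\<close> are
      unspecified.\<close>
    also have "\<dots> = (\<Sum>K\<in>snd ` q. if K = {} then 0 else \<bar>?inc K\<bar>)"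
    proof (rule sum.cong[OF refl])
      fix K assume K: "K \<in> snd ` q"
      show "\<bar>?inc K\<bar> = (if K = {} then 0 else \<bar>?inc K\<bar>)" using rep[OF K] by auto
    qed
    also have "\<dots> = (\<Sum>(x, K)\<in>q. if K = {} then 0 else \<bar>?inc K\<bar>)"
    proof (rule sum.over_tagged_division_lemma[OF q, symmetric])
      fix c d :: real assume "box c d = {}"
      then show "(if cbox c d = {} then 0 else \<bar>?inc (cbox c d)\<bar>) = 0" by (cases "c = d") auto
    qed
    also have "\<dots> = (\<Sum>(x, K)\<in>q. \<bar>?inc K\<bar>)"
    proof (rule sum.cong[OF refl], clarify)
      fix x K assume "(x, K) \<in> q"
      then have K: "K \<in> snd ` q" by force
      show "(if K = {} then 0 else \<bar>?inc K\<bar>) = \<bar>?inc K\<bar>" using rep[OF K] by auto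
    qed
    finally have "(\<Sum>(x, K)\<in>q. \<bar>?inc K\<bar>) < \<epsilon>" .
    moreover have "(\<Sum>(x, K)\<in>q. ?inc K) \<le> (\<Sum>(x, K)\<in>q. \<bar>?inc K\<bar>)"
      by (rule sum_mono) auto
    ultimately show ?thesis by linarith
  qed
  finally have "f b - f a \<le> \<epsilon> + \<epsilon> * (b - a)" by simp
  also have "\<dots> = \<epsilon> * (b - a + 1)" by (simp add: algebra_simps)
  also have "\<dots> = e" using \<open>a \<le> b\<close> by (simp add: \<epsilon>_def)
  finally show "f b \<le> f a + e" by simp
qed

section \<open>A single damped oscillator\<close>

text \<open>
  Bound for \<open>u'\<^sup>2\<close>, relative to the energy, at distance at most \<open>h\<close> after a pulse of strength \<open>K\<close>
  and duration \<open>h / 3\<close>.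
\<close>

definition pulse_defect :: "real \<Rightarrow> real \<Rightarrow> real \<Rightarrow> real" where
  "pulse_defect l K h = exp (- 4 * K * (h / 3)) + l / (4 * K) + l * h"

text \<open>The first summand is for the kinetic and the square for the potential part of the final
  energy. In the square, \<open>2 * l * h\<close> is the phase missing from a quarter turn, another
  \<open>l * h\<close> is the drift during the final stretch of length \<open>h\<close>, and the
  root is the velocity left by the first pulse.\<close>

definition slot_factor :: "real \<Rightarrow> real \<Rightarrow> real \<Rightarrow> real" where
  "slot_factor l K h = pulse_defect l K h + (3 * l * h + sqrt (pulse_defect l K h))\<^sup>2"

text \<open>Common form of both notions of solution: \<open>N\<close> is the exceptional null set of
  the equation, whereas \<open>v\<close> is the derivative of \<open>u\<close> at every
  time.\<close>

locale damped_oscillator =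
  fixes \<delta> u v :: "real \<Rightarrow> real" and l :: real and N :: "real set"
  assumes l_pos: "l > 0"
    and damping_nonneg: "\<And>t. t \<ge> 0 \<Longrightarrow> \<delta> t \<ge> 0"
    and deriv_u: "\<And>t. t \<ge> 0 \<Longrightarrow> (u has_real_derivative v t) (at t within {0..})"
    and cont_v: "continuous_on {0..} v"
    and abs_continuous_v: "\<And>a b. 0 \<le> a \<Longrightarrow> a \<le> b \<Longrightarrow> abs_continuous_on_Icc a b v"
    and negligible_N: "negligible N"
    and deriv_v: "\<And>t. t \<ge> 0 \<Longrightarrow> t \<notin> N \<Longrightarrow>
      (v has_real_derivative - 2 * \<delta> t * v t - l\<^sup>2 * u t) (at t within {0..})"
begin

definition E :: "real \<Rightarrow> real" where "E t = (v t)\<^sup>2 + l\<^sup>2 * (u t)\<^sup>2"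

lemma E_nonneg: "E t \<ge> 0"
  by (simp add: E_def)

lemma cont_u: "continuous_on {0..} u"
  by (rule DERIV_continuous_on) (use deriv_u in auto)

lemma abs_continuous_u:
  assumes "0 \<le> a" "a \<le> b" shows "abs_continuous_on_Icc a b u"
proof (rule abs_continuous_on_Icc_C1)
  show "(u has_real_derivative v x) (at x within {a..b})" if "x \<in> {a..b}" for x
    using that assms by (intro DERIV_subset[OF deriv_u]) auto
  show "continuous_on {a..b} v"
    by (rule continuous_on_subset[OF cont_v]) (use assms in auto)
qed

text \<open>Takes the place of integration and of Gronwall's inequality below. The candidate
  \<open>f'\<close> is a formula in \<open>u\<close> and \<open>v\<close>, so its sign can be
  checked on all of \<open>{a..b}\<close>, although it is the derivative only off
  \<open>N\<close>.\<close>

lemma nonincreasing: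
  assumes "0 \<le> a" "a \<le> b" "abs_continuous_on_Icc a b f"
    and "\<And>t. t \<in> {a..b} \<Longrightarrow> t \<notin> N \<Longrightarrow> (f has_real_derivative f' t) (at t within {0..})"
    and "\<And>t. t \<in> {a..b} \<Longrightarrow> f' t \<le> 0"
  shows "f b \<le> f a"
proof (rule abs_continuous_on_Icc_nonincreasing[OF assms(2,3) negligible_N])
  fix t assume t: "t \<in> {a..b} - N"
  have "(f has_real_derivative f' t) (at t within {a..b})"
    by (rule DERIV_subset[OF assms(4)]) (use t assms in auto)
  then show "\<exists>D\<le>0. (f has_real_derivative D) (at t within {a..b})"
    using assms(5) t by blast
qed

lemma cont_within:
  assumes "0 \<le> a" shows "continuous_on {a..b} u" "continuous_on {a..b} v"
  by (rule continuous_on_subset[OF cont_u] continuous_on_subset[OF cont_v]; use assms in auto)+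

lemmas abs_continuous_intros = abs_continuous_on_Icc_const abs_continuous_on_Icc_add
  abs_continuous_on_Icc_mult abs_continuous_u abs_continuous_v

lemma energy_antimono:
  assumes "0 \<le> a" "a \<le> b" shows "E b \<le> E a"
proof (rule nonincreasing[OF assms])
  have "abs_continuous_on_Icc a b (\<lambda>t. v t * v t + l\<^sup>2 * (u t * u t))"
    using assms cont_within[OF assms(1), of b]
    by (intro abs_continuous_intros continuous_intros) auto
  then show "abs_continuous_on_Icc a b E" by (simp add: E_def[abs_def] power2_eq_square)
  show "(E has_real_derivative - 4 * \<delta> t * (v t)\<^sup>2) (at t within {0..})"
    if "t \<in> {a..b}" "t \<notin> N" for t
    unfolding E_def[abs_def]
    by (rule derivative_eq_intros deriv_u deriv_v refl | use that assms in force)+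
      (simp add: algebra_simps power2_eq_square)
  show "- 4 * \<delta> t * (v t)\<^sup>2 \<le> 0" if "t \<in> {a..b}" for t
    using damping_nonneg[of t] that assms by simp
qed

text \<open>Completing the square. The left side is the contribution of the restoring force to the
  derivative of \<open>v\<^sup>2\<close>, hence the only way in which the velocity can grow.\<close>

lemma cross_term_le: "- (2 * l\<^sup>2 * u t * v t) \<le> l * E t"
proof -
  have "0 \<le> l * (v t + l * u t)\<^sup>2" using l_pos by simp
  then show ?thesis by (simp add: E_def power2_eq_square algebra_simps)
qed

text \<open>During the pulse \<open>y = v\<^sup>2\<close> satisfies
  \<open>y' \<le> - 4 * K * y + l * E a\<close>. The constant \<open>c\<close> in the proof is the
  equilibrium of this linear inequality, and \<open>g\<close> is the distance to it times the
  integrating factor.\<close>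

lemma velocity_pulse_bound:
  assumes ab: "0 \<le> a" "a \<le> b" and "K > 0" and K: "\<And>t. t \<in> {a..b} \<Longrightarrow> \<delta> t \<ge> K"
  shows "(v b)\<^sup>2 \<le> (exp (- 4 * K * (b - a)) + l / (4 * K)) * E a"
proof -
  define c where "c = l / (4 * K) * E a"
  define g where "g t = exp (4 * K * (t - a)) * ((v t)\<^sup>2 - c)" for t
  have c: "4 * K * c = l * E a" using \<open>K > 0\<close> by (simp add: c_def)
  have c0: "c \<ge> 0" using E_nonneg l_pos \<open>K > 0\<close> by (simp add: c_def)
  have "g b \<le> g a"
  proof (rule nonincreasing[OF ab])
    have "abs_continuous_on_Icc a b (\<lambda>t. exp (4 * K * (t - a)))"
      by (rule abs_continuous_on_Icc_C1[where f' = "\<lambda>t. exp (4 * K * (t - a)) * (4 * K)"])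
        (auto intro!: derivative_eq_intros continuous_intros)
    then have "abs_continuous_on_Icc a b (\<lambda>t. exp (4 * K * (t - a)) * (v t * v t + (- c)))"
      using ab cont_within[OF ab(1), of b]
      by (intro abs_continuous_intros continuous_intros) auto
    then show "abs_continuous_on_Icc a b g" by (simp add: g_def[abs_def] power2_eq_square)
    show "(g has_real_derivative exp (4 * K * (t - a)) *
        (4 * K * ((v t)\<^sup>2 - c) - 4 * \<delta> t * (v t)\<^sup>2 - 2 * l\<^sup>2 * u t * v t)) (at t within {0..})"
      if "t \<in> {a..b}" "t \<notin> N" for t
      unfolding g_def[abs_def]
      by (rule derivative_eq_intros deriv_u deriv_v refl | use that ab in force)+
        (simp add: algebra_simps power2_eq_square)
    show "exp (4 * K * (t - a)) *
        (4 * K * ((v t)\<^sup>2 - c) - 4 * \<delta> t * (v t)\<^sup>2 - 2 * l\<^sup>2 * u t * v t) \<le> 0" if "t \<in> {a..b}" for t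
    proof -
      have "l * E t \<le> l * E a"
        using energy_antimono[of a t] that ab l_pos by simp
      then have "- (2 * l\<^sup>2 * u t * v t) \<le> 4 * K * c" using cross_term_le[of t] c by linarith
      moreover have "K * (v t)\<^sup>2 \<le> \<delta> t * (v t)\<^sup>2" using K[OF that] by (intro mult_right_mono) auto
      moreover have "4 * K * ((v t)\<^sup>2 - c) = 4 * (K * (v t)\<^sup>2) - 4 * K * c"
        by (simp add: right_diff_distrib)
      ultimately have "4 * K * ((v t)\<^sup>2 - c) - 4 * \<delta> t * (v t)\<^sup>2 - 2 * l\<^sup>2 * u t * v t \<le> 0"
        by linarith
      then show ?thesis by (simp add: mult_le_0_iff)
    qed
  qed
  then have "exp (4 * K * (b - a)) * ((v b)\<^sup>2 - c) \<le> (v a)\<^sup>2 - c" by (simp add: g_def)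
  also have "\<dots> \<le> E a" using c0 by (simp add: E_def add_increasing2)
  finally have "exp (- (4 * K * (b - a))) * (exp (4 * K * (b - a)) * ((v b)\<^sup>2 - c))
      \<le> exp (- (4 * K * (b - a))) * E a"
    by (intro mult_left_mono) auto
  moreover have "exp (- (4 * K * (b - a))) * (exp (4 * K * (b - a)) * ((v b)\<^sup>2 - c)) = (v b)\<^sup>2 - c"
    by (simp only: mult.assoc[symmetric] exp_add[symmetric]) simp
  ultimately have "(v b)\<^sup>2 \<le> exp (- (4 * K * (b - a))) * E a + c" by linarith
  then show ?thesis by (simp add: c_def distrib_right)
qed

text \<open>Damping only slows down, so the restoring force alone limits the growth. This bridges
  the zone after the strong part of a pulse, where nothing but the sign of \<delta> is
  known.\<close>

lemma velocity_growth_bound: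
  assumes ab: "0 \<le> a" "a \<le> b"
  shows "(v b)\<^sup>2 \<le> (v a)\<^sup>2 + l * (b - a) * E a"
proof -
  define g where "g t = (v t)\<^sup>2 + (- l * E a) * t" for t
  have "g b \<le> g a"
  proof (rule nonincreasing[OF ab])
    have "abs_continuous_on_Icc a b (\<lambda>t. v t * v t + (- l * E a) * t)"
      using ab cont_within[OF ab(1), of b]
      by (intro abs_continuous_intros continuous_intros abs_continuous_on_Icc_lipschitz[of _ _ "\<lambda>t. t" 1]) auto
    then show "abs_continuous_on_Icc a b g" by (simp add: g_def[abs_def] power2_eq_square)
    show "(g has_real_derivative - 4 * \<delta> t * (v t)\<^sup>2 - 2 * l\<^sup>2 * u t * v t - l * E a) (at t within {0..})"
      if "t \<in> {a..b}" "t \<notin> N" for t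
      unfolding g_def[abs_def]
      by (rule derivative_eq_intros deriv_u deriv_v refl | use that ab in force)+
        (simp add: algebra_simps power2_eq_square)
    show "- 4 * \<delta> t * (v t)\<^sup>2 - 2 * l\<^sup>2 * u t * v t - l * E a \<le> 0" if "t \<in> {a..b}" for t
    proof -
      have "l * E t \<le> l * E a"
        using energy_antimono[of a t] that ab l_pos by simp
      moreover have "0 \<le> \<delta> t * (v t)\<^sup>2" using damping_nonneg[of t] that ab by simp
      ultimately show ?thesis using cross_term_le[of t] by linarith
    qed
  qed
  then show ?thesis by (simp add: g_def algebra_simps)
qed

text \<open>The conserved quantity is the value at time \<open>b\<close> of the undamped solution through \<open>(u t, v t)\<close>.\<close>

lemma free_motion:
  assumes ab: "0 \<le> a" "a \<le> b" and zero: "\<And>t. t \<in> {a..b} \<Longrightarrow> \<delta> t = 0"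
  shows "l * u b = l * u a * cos (l * (b - a)) + v a * sin (l * (b - a))"
proof -
  \<comment> \<open>The sign \<open>c\<close> turns monotonicity into conservation: the cases
    \<open>c = 1\<close> and \<open>c = -1\<close> give the two inequalities.\<close>
  define w where "w c t = c * (l * u t * cos (l * (b - t)) + v t * sin (l * (b - t)))" for c t
  have w: "w c b \<le> w c a" for c
  proof (rule nonincreasing[OF ab])
    have "abs_continuous_on_Icc a b (\<lambda>t. cos (l * (b - t)))"
      by (rule abs_continuous_on_Icc_C1[where f' = "\<lambda>t. l * sin (l * (b - t))"])
        (auto intro!: derivative_eq_intros continuous_intros)
    moreover have "abs_continuous_on_Icc a b (\<lambda>t. sin (l * (b - t)))"
      by (rule abs_continuous_on_Icc_C1[where f' = "\<lambda>t. - l * cos (l * (b - t))"])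
        (auto intro!: derivative_eq_intros continuous_intros)
    ultimately show "abs_continuous_on_Icc a b (w c)"
      unfolding w_def[abs_def] using ab cont_within[OF ab(1), of b]
      by (intro abs_continuous_intros continuous_intros) auto
    show "(w c has_real_derivative 0) (at t within {0..})" if "t \<in> {a..b}" "t \<notin> N" for t
      unfolding w_def[abs_def]
      by (rule derivative_eq_intros deriv_u deriv_v refl | use that ab in force)+
        (simp add: zero[OF that(1)] algebra_simps power2_eq_square)
  qed simp
  show ?thesis using w[of 1] w[of "-1"] by (simp add: w_def)
qed

text \<open>The energy bounds the speed whatever the damping is, so this applies on the last stretch
  of a slot, where \<delta> is not prescribed throughout.\<close>

lemma displacement_bound:
  assumes ab: "0 \<le> a" "a \<le> b"
  shows "\<bar>u b - u a\<bar> \<le> sqrt (E a) * (b - a)"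
proof -
  have "norm (u b - u a) \<le> sqrt (E a) * norm (b - a)"
  proof (rule field_differentiable_bound[where S = "{a..b}" and f' = v])
    show "(u has_real_derivative v t) (at t within {a..b})" if "t \<in> {a..b}" for t
      using that ab by (intro DERIV_subset[OF deriv_u]) auto
    show "norm (v t) \<le> sqrt (E a)" if "t \<in> {a..b}" for t
    proof -
      have "(v t)\<^sup>2 \<le> E t" by (simp add: E_def)
      also have "\<dots> \<le> E a" using energy_antimono that ab by simp
      finally show ?thesis by (simp add: real_le_rsqrt abs_le_square_iff)
    qed
  qed (use ab in auto)
  then show ?thesis using ab by simp
qed

text \<open>
  The first pulse stops the oscillator, a quarter period later it passes through 0 with all its energy
  kinetic, and the second pulse absorbs this energy.
\<close>

lemma slot_decay:
  assumes "0 \<le> s" and h: "0 < h" "2 * h \<le> pi / (2 * l)" and "K > 0" and L: "L = pi / (2 * l)"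
    and first: "\<And>t. t \<in> {s..s + h / 3} \<Longrightarrow> \<delta> t \<ge> K"
    and free: "\<And>t. t \<in> {s + h..s + L - h} \<Longrightarrow> \<delta> t = 0"
    and second: "\<And>t. t \<in> {s + L - h / 3..s + L} \<Longrightarrow> \<delta> t \<ge> K"
  shows "E (s + L) \<le> slot_factor l K h * E s"
proof -
  let ?\<rho> = "pulse_defect l K h"
  define M where "M = E s"
  have M: "M \<ge> 0" by (simp add: M_def E_nonneg)
  have lh: "l * h \<ge> 0" using l_pos h by simp
  have \<rho>: "?\<rho> \<ge> 0" using lh l_pos \<open>K > 0\<close> by (simp add: pulse_defect_def)
  have hL: "2 * h \<le> L" using h L by simp
  have EM: "E t \<le> M" if "t \<ge> s" for t using energy_antimono[OF \<open>0 \<le> s\<close> that] by (simp add: M_def)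
  \<comment> \<open>The strong part of the pulse ends at \<open>s + h / 3\<close>; the remaining
    \<open>2 * h / 3\<close>, rounded up to \<open>h\<close>, yields the last term of
    \<open>pulse_defect\<close>.\<close>
  have "(v (s + h))\<^sup>2 \<le> ?\<rho> * M"
  proof -
    have "(v (s + h / 3))\<^sup>2 \<le> (exp (- 4 * K * (h / 3)) + l / (4 * K)) * M"
      using velocity_pulse_bound[of s "s + h / 3" K] assms by (simp add: M_def)
    moreover have "(v (s + h))\<^sup>2 \<le> (v (s + h / 3))\<^sup>2 + l * (2 * h / 3) * E (s + h / 3)"
      using velocity_growth_bound[of "s + h / 3" "s + h"] h \<open>0 \<le> s\<close> by simp
    moreover have "l * (2 * h / 3) * E (s + h / 3) \<le> l * h * M"
      using lh l_pos h EM[of "s + h / 3"] E_nonneg M by (intro mult_mono) auto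
    ultimately show ?thesis by (simp add: pulse_defect_def algebra_simps)
  qed
  then have v1: "\<bar>v (s + h)\<bar> \<le> sqrt ?\<rho> * sqrt M"
    by (metis real_sqrt_abs real_sqrt_le_iff real_sqrt_mult)
  have u_bound: "\<bar>l * u t\<bar> \<le> sqrt M" if "t \<ge> s" for t
  proof -
    have "(l * u t)\<^sup>2 \<le> E t" by (simp add: E_def power_mult_distrib)
    then have "(l * u t)\<^sup>2 \<le> M" using EM[OF that] by linarith
    then show ?thesis by (metis real_sqrt_abs real_sqrt_le_iff)
  qed
  have u1: "\<bar>l * u (s + L - h)\<bar> \<le> (2 * l * h + sqrt ?\<rho>) * sqrt M"
  proof -
    \<comment> \<open>Phase covered by the free motion. It falls short of a quarter turn by
      \<open>2 * l * h\<close>, so the cosine that multiplies the initial position is of that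
      order.\<close>
    define \<theta> where "\<theta> = l * (L - 2 * h)"
    have \<theta>: "\<theta> = pi / 2 - 2 * l * h" using l_pos by (simp add: \<theta>_def L algebra_simps)
    have "cos \<theta> = sin (2 * l * h)" unfolding \<theta> by (simp add: cos_diff)
    then have cos: "\<bar>cos \<theta>\<bar> \<le> 2 * l * h"
      using abs_sin_x_le_abs_x[of "2 * l * h"] lh by simp
    have "l * u (s + L - h) = l * u (s + h) * cos \<theta> + v (s + h) * sin \<theta>"
      using free_motion[of "s + h" "s + L - h"] free hL h \<open>0 \<le> s\<close> by (simp add: \<theta>_def algebra_simps)
    then have "\<bar>l * u (s + L - h)\<bar> \<le> \<bar>l * u (s + h)\<bar> * \<bar>cos \<theta>\<bar> + \<bar>v (s + h)\<bar> * \<bar>sin \<theta>\<bar>"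
      by (metis abs_mult abs_triangle_ineq)
    also have "\<dots> \<le> sqrt M * (2 * l * h) + (sqrt ?\<rho> * sqrt M) * 1"
      using h v1 cos u_bound[of "s + h"] \<rho> M by (intro add_mono mult_mono) auto
    finally show ?thesis by (simp add: algebra_simps)
  qed
  have u2: "\<bar>l * u (s + L)\<bar> \<le> (3 * l * h + sqrt ?\<rho>) * sqrt M"
  proof -
    have "\<bar>u (s + L) - u (s + L - h)\<bar> \<le> sqrt (E (s + L - h)) * h"
      using displacement_bound[of "s + L - h" "s + L"] hL h \<open>0 \<le> s\<close> by simp
    also have "\<dots> \<le> sqrt M * h" using EM[of "s + L - h"] hL h by (intro mult_right_mono) auto
    finally have "l * \<bar>u (s + L) - u (s + L - h)\<bar> \<le> l * (sqrt M * h)"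
      using l_pos by (intro mult_left_mono) auto
    then have "\<bar>l * u (s + L) - l * u (s + L - h)\<bar> \<le> l * h * sqrt M"
      using l_pos by (simp add: abs_mult right_diff_distrib[symmetric] mult_ac del: right_diff_distrib)
    then show ?thesis using u1 by (simp add: algebra_simps)
  qed
  have v2: "(v (s + L))\<^sup>2 \<le> ?\<rho> * M"
  proof -
    have "(v (s + L))\<^sup>2 \<le> (exp (- 4 * K * (h / 3)) + l / (4 * K)) * E (s + L - h / 3)"
      using velocity_pulse_bound[of "s + L - h / 3" "s + L" K] assms hL h by simp
    also have "\<dots> \<le> ?\<rho> * M"
      using EM[of "s + L - h / 3"] hL h lh l_pos \<open>K > 0\<close> E_nonneg
      by (intro mult_mono) (auto simp: pulse_defect_def)
    finally show ?thesis .
  qed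
  have "(l * u (s + L))\<^sup>2 \<le> ((3 * l * h + sqrt ?\<rho>) * sqrt M)\<^sup>2"
    using u2 by (simp add: abs_le_square_iff[symmetric])
  also have "\<dots> = (3 * l * h + sqrt ?\<rho>)\<^sup>2 * M" using M by (simp add: power_mult_distrib)
  finally show ?thesis using v2 by (simp add: E_def power_mult_distrib M_def slot_factor_def algebra_simps)
qed

end

section \<open>From solutions of the system to damped oscillators\<close>

lemma half_line_deriv_eqI:
  assumes "t \<ge> 0" "(f has_real_derivative D) (at t within {0..})"
  shows "half_line_deriv f t = D"
proof -
  \<comment> \<open>Uniqueness of the derivative needs a nontrivial filter; approaching from the
    right also covers the boundary point 0.\<close>
  have "at t within {0..} \<noteq> bot"
    using at_le[of "{t<..}" "{0..}" t] assms(1) trivial_limit_at_right_real[of t]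
    by (metis atLeast_iff bot.extremum_uniqueI greaterThan_iff less_imp_le order_trans subsetI)
  then show ?thesis unfolding half_line_deriv_def
    using assms(2) by (intro vector_derivative_within) (simp_all add: has_real_derivative_iff_has_vector_derivative)
qed

lemma half_line_deriv_works:
  assumes "f differentiable (at t within {0..})"
  shows "(f has_real_derivative half_line_deriv f t) (at t within {0..})"
  using assms unfolding half_line_deriv_def has_real_derivative_iff_has_vector_derivative
  by (simp add: vector_derivative_works)

text \<open>For continuous \<delta> the equation itself makes the derivative of \<open>u'\<close>
  continuous, so \<open>u'\<close> is absolutely continuous on bounded intervals and
  \<open>N\<close> is empty. Otherwise \<open>N\<close> is a null set supplied by the
  almost-everywhere quantifier.\<close>

lemma damped_solution_oscillator:
  assumes sol: "damped_solution \<delta> l u" and "l > 0" and nonneg: "\<And>t. t \<ge> 0 \<Longrightarrow> \<delta> t \<ge> 0"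
  shows "\<exists>N. damped_oscillator \<delta> u (half_line_deriv u) l N"
proof -
  let ?v = "half_line_deriv u"
  have u: "(u has_real_derivative ?v t) (at t within {0..})" if "t \<ge> 0" for t
    using sol that half_line_deriv_works
    by (auto simp: damped_solution_def C1_half_line_def differentiable_on_def)
  have cv: "continuous_on {0..} ?v" using sol by (auto simp: damped_solution_def C1_half_line_def)
  have v: "(?v has_real_derivative - 2 * \<delta> t * ?v t - l\<^sup>2 * u t) (at t within {0..})"
    if "damped_eq_at \<delta> l u t" for t
  proof -
    have "half_line_deriv ?v t = - 2 * \<delta> t * ?v t - l\<^sup>2 * u t"
      using that by (simp add: damped_eq_at_def)
    then show ?thesis using half_line_deriv_works[of ?v t] that by (simp add: damped_eq_at_def)
  qed
  show ?thesis
  proof (cases "continuous_on {0..} \<delta>")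
    case True
    then have eq: "damped_eq_at \<delta> l u t" if "t \<ge> 0" for t
      using sol that by (simp add: damped_solution_def)
    have "abs_continuous_on_Icc a b ?v" if ab: "0 \<le> a" "a \<le> b" for a b
    proof (rule abs_continuous_on_Icc_C1)
      show "(?v has_real_derivative - 2 * \<delta> t * ?v t - l\<^sup>2 * u t) (at t within {a..b})"
        if "t \<in> {a..b}" for t
        by (rule DERIV_subset[OF v[OF eq]]) (use that ab in auto)
      have "continuous_on {0..} u" by (rule DERIV_continuous_on) (use u in auto)
      then have "continuous_on {0..} (\<lambda>t. - 2 * \<delta> t * ?v t - l\<^sup>2 * u t)"
        using True cv by (intro continuous_intros)
      then show "continuous_on {a..b} (\<lambda>t. - 2 * \<delta> t * ?v t - l\<^sup>2 * u t)"
        by (rule continuous_on_subset) (use ab in auto)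
    qed
    then have "damped_oscillator \<delta> u ?v l {}"
      using assms u cv v eq by unfold_locales auto
    then show ?thesis ..
  next
    case False
    then have ac: "loc_abs_continuous_half_line ?v" and ae: "AE t in lebesgue. 0 \<le> t \<longrightarrow> damped_eq_at \<delta> l u t"
      using sol by (auto simp: damped_solution_def)
    obtain N where N: "N \<in> null_sets lebesgue" "\<And>t. t \<notin> N \<Longrightarrow> 0 \<le> t \<longrightarrow> damped_eq_at \<delta> l u t"
      using ae unfolding eventually_ae_filter by auto
    have "damped_oscillator \<delta> u ?v l N"
      using assms u cv v N ac
      by unfold_locales (auto simp: negligible_iff_null_sets loc_abs_continuous_half_line_def)
    then show ?thesis ..
  qed
qed

section \<open>Smooth functions\<close>

text \<open>Two-sided derivatives on the whole line, given by witnesses rather than by an operator,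
  make every closure rule an induction on the order. The passage to the half line is made only
  once.\<close>

fun times_differentiable :: "nat \<Rightarrow> (real \<Rightarrow> real) \<Rightarrow> bool" where
  "times_differentiable 0 f \<longleftrightarrow> True"
| "times_differentiable (Suc n) f \<longleftrightarrow>
     (\<exists>f'. (\<forall>x. (f has_real_derivative f' x) (at x)) \<and> times_differentiable n f')"

lemma times_differentiable_SucI:
  "(\<And>x. (f has_real_derivative f' x) (at x)) \<Longrightarrow> times_differentiable n f' \<Longrightarrow>
    times_differentiable (Suc n) f"
  by auto

lemma times_differentiable_pred: "times_differentiable (Suc n) f \<Longrightarrow> times_differentiable n f"
proof (induction n arbitrary: f)
  case (Suc n)
  then obtain f' where "\<And>x. (f has_real_derivative f' x) (at x)" "times_differentiable (Suc n) f'"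
    by (metis times_differentiable.simps(2))
  then show ?case using Suc.IH by (intro times_differentiable_SucI)
qed simp

lemma times_differentiable_const: "times_differentiable n (\<lambda>x. c)"
proof (induction n arbitrary: c)
  case (Suc n)
  then show ?case by (intro times_differentiable_SucI[OF DERIV_const])
qed simp

lemma times_differentiable_affine: "times_differentiable n (\<lambda>x. a * x + b)"
proof (cases n)
  case (Suc m)
  have "((\<lambda>x. a * x + b) has_real_derivative a) (at x)" for x
    by (auto intro!: derivative_eq_intros)
  then show ?thesis unfolding Suc by (rule times_differentiable_SucI) (rule times_differentiable_const)
qed simp

lemma times_differentiable_add:
  "times_differentiable n f \<Longrightarrow> times_differentiable n g \<Longrightarrow> times_differentiable n (\<lambda>x. f x + g x)"
proof (induction n arbitrary: f g)
  case (Suc n)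
  then obtain f' g' where "\<And>x. (f has_real_derivative f' x) (at x)" "times_differentiable n f'"
    "\<And>x. (g has_real_derivative g' x) (at x)" "times_differentiable n g'" by auto
  with Suc.IH show ?case by (intro times_differentiable_SucI[OF DERIV_add])
qed simp

lemma times_differentiable_mult:
  "times_differentiable n f \<Longrightarrow> times_differentiable n g \<Longrightarrow> times_differentiable n (\<lambda>x. f x * g x)"
proof (induction n arbitrary: f g)
  case (Suc n)
  then obtain f' g' where D: "\<And>x. (f has_real_derivative f' x) (at x)" "times_differentiable n f'"
    "\<And>x. (g has_real_derivative g' x) (at x)" "times_differentiable n g'" by auto
  have "times_differentiable n (\<lambda>x. f' x * g x + g' x * f x)"
    using Suc D times_differentiable_pred by (intro times_differentiable_add) blast+
  then show ?case
    by (rule times_differentiable_SucI[OF DERIV_mult[OF D(1) D(3)]])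
qed simp

lemma times_differentiable_compose:
  "times_differentiable n f \<Longrightarrow> times_differentiable n g \<Longrightarrow> times_differentiable n (\<lambda>x. f (g x))"
proof (induction n arbitrary: f g)
  case (Suc n)
  then obtain f' g' where D: "\<And>x. (f has_real_derivative f' x) (at x)" "times_differentiable n f'"
    "\<And>x. (g has_real_derivative g' x) (at x)" "times_differentiable n g'" by auto
  have "times_differentiable n (\<lambda>x. f' (g x) * g' x)"
    using Suc D times_differentiable_pred by (intro times_differentiable_mult) blast+
  then show ?case
    by (rule times_differentiable_SucI[OF DERIV_chain2[OF D(1) D(3)]])
qed simp

lemma times_differentiable_sum:
  "finite A \<Longrightarrow> (\<And>i. i \<in> A \<Longrightarrow> times_differentiable n (f i)) \<Longrightarrow>
    times_differentiable n (\<lambda>x. \<Sum>i\<in>A. f i x)"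
  by (induction A rule: finite_induct) (auto simp: times_differentiable_const times_differentiable_add)

text \<open>Differentiating the sine shifts its phase by \<open>pi / 2\<close>; with the phase
  generalised the induction closes without a companion statement for the cosine.\<close>

lemma times_differentiable_sin: "times_differentiable n (\<lambda>x. sin (x + c))"
proof (induction n arbitrary: c)
  case (Suc n)
  have "((\<lambda>x. sin (x + c)) has_real_derivative sin (x + (c + pi / 2))) (at x)" for x
    by (auto intro!: derivative_eq_intros simp: sin_add[of "x + c" "pi / 2"] add.assoc[symmetric])
  then show ?case using Suc by (rule times_differentiable_SucI)
qed simp

lemma times_differentiable_imp_smooth_half_line:
  assumes "\<And>n. times_differentiable n f"
  shows "smooth_half_line f"
proof -
  have "(half_line_deriv ^^ m) f differentiable_on {0..}" for m
  proof -
    have "\<exists>g. times_differentiable 1 g \<and> (\<forall>t\<ge>0. (half_line_deriv ^^ m) f t = g t)"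
    proof -
      \<comment> \<open>The order \<open>j\<close> has to stay arbitrary, because each further
        derivative uses up one order of the witness.\<close>
      have "\<exists>g. times_differentiable j g \<and> (\<forall>t\<ge>0. (half_line_deriv ^^ m) f t = g t)" for j
      proof (induction m arbitrary: j)
        case 0
        then show ?case using assms by auto
      next
        case (Suc m)
        obtain g where g: "times_differentiable (Suc j) g"
          and eq: "\<And>t. t \<ge> 0 \<Longrightarrow> (half_line_deriv ^^ m) f t = g t"
          using Suc[of "Suc j"] by blast
        then obtain g' where g': "\<And>x. (g has_real_derivative g' x) (at x)" "times_differentiable j g'"
          by auto
        have "(half_line_deriv ^^ Suc m) f t = g' t" if "t \<ge> 0" for t
        proof -
          have "((half_line_deriv ^^ m) f has_real_derivative g' t) (at t within {0..})"
            by (rule has_field_derivative_transform_within[OF DERIV_subset[OF g'(1)], where d = 1])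
              (use that eq in auto)
          then show ?thesis using half_line_deriv_eqI[OF that] by simp
        qed
        then show ?case using g'(2) by blast
      qed
      then show ?thesis .
    qed
    then obtain g g' where eq: "\<And>t. t \<ge> 0 \<Longrightarrow> (half_line_deriv ^^ m) f t = g t"
      and g': "\<And>x. (g has_real_derivative g' x) (at x)" by auto
    have "(half_line_deriv ^^ m) f differentiable (at t within {0..})" if "t \<ge> 0" for t
    proof -
      have "((half_line_deriv ^^ m) f has_real_derivative g' t) (at t within {0..})"
        by (rule has_field_derivative_transform_within[OF DERIV_subset[OF g'(1)], where d = 1])
          (use that eq in auto)
      then show ?thesis using real_differentiable_def by blast
    qed
    then show ?thesis by (simp add: differentiable_on_def)
  qed
  then show ?thesis by (simp add: smooth_half_line_def)
qed

text \<open>The classical function \<open>exp (- 1 / x)\<close> extended by 0 is the case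
  \<open>k = 0\<close>; the powers in the denominator make the family closed under differentiation
  up to linear combinations.\<close>

definition flat :: "nat \<Rightarrow> real \<Rightarrow> real" where
  "flat k x = (if x > 0 then exp (- 1 / x) / x ^ k else 0)"

lemma flat_nonneg: "flat k x \<ge> 0"
  by (simp add: flat_def)

lemma flat_tendsto_0: "(flat k \<longlongrightarrow> 0) (at 0)"
proof -
  have "((\<lambda>x. inverse x ^ k / exp (inverse x)) \<longlongrightarrow> 0) (at_right (0::real))"
    by (rule filterlim_compose[OF tendsto_power_div_exp_0 filterlim_inverse_at_top_right])
  moreover have "\<forall>\<^sub>F x in at_right 0. inverse x ^ k / exp (inverse x) = flat k x"
    using eventually_at_right_less[of "0::real"]
    by eventually_elim (simp add: flat_def exp_minus field_simps)
  ultimately have "(flat k \<longlongrightarrow> 0) (at_right 0)" by (rule Lim_transform_eventually)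
  moreover have "(flat k \<longlongrightarrow> 0) (at_left 0)"
  proof (rule Lim_transform_eventually[OF tendsto_const])
    have "\<forall>\<^sub>F x in at_left 0. x < (0::real)" by (simp add: eventually_at_filter)
    then show "\<forall>\<^sub>F x in at_left 0. 0 = flat k x" by eventually_elim (simp add: flat_def)
  qed
  ultimately show ?thesis by (simp add: filterlim_at_split)
qed

text \<open>The derivative is written with a sum and a product, without subtraction, to match the
  closure rules for \<open>times_differentiable\<close>.\<close>

lemma flat_deriv:
  "(flat k has_real_derivative flat (k + 2) x + (- real k) * flat (k + 1) x) (at x)"
proof (cases x "0::real" rule: linorder_cases)
  case less
  have "((\<lambda>x. 0) has_real_derivative 0) (at x)" by simp
  then have "(flat k has_real_derivative 0) (at x)"
    by (rule has_field_derivative_transform_within_open[of _ _ _ "{..<0}"])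
      (use less in \<open>auto simp: flat_def\<close>)
  then show ?thesis using less by (simp add: flat_def)
next
  case equal
  \<comment> \<open>At 0 the difference quotient of \<open>flat k\<close> is
    \<open>flat (Suc k)\<close>.\<close>
  have "((\<lambda>h. (flat k (0 + h) - flat k 0) / h) \<longlongrightarrow> 0) (at 0)"
    by (rule Lim_transform_eventually[OF flat_tendsto_0[of "Suc k"]])
      (auto simp: flat_def eventually_at_filter)
  then show ?thesis using equal by (simp add: DERIV_def flat_def)
next
  case greater
  have "((\<lambda>x. exp (- 1 / x) / x ^ k) has_real_derivative
      flat (k + 2) x + (- real k) * flat (k + 1) x) (at x)"
  proof -
    define y where "y = inverse x"
    have "((\<lambda>x. exp (- inverse x) * inverse x ^ k) has_real_derivative
        exp (- y) * (y * y) * y ^ k + exp (- y) * (real k * y ^ (k - 1) * (- (y * y)))) (at x)"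
      unfolding y_def using greater by (auto intro!: derivative_eq_intros)
    \<comment> \<open>For \<open>k = 0\<close> the exponent \<open>k - 1\<close> is truncated, but
      the factor \<open>real k\<close> vanishes.\<close>
    moreover have "real k * y ^ (k - 1) * (- (y * y)) = - real k * y ^ (k + 1)"
      by (cases k) (auto simp: algebra_simps)
    ultimately have "((\<lambda>x. exp (- inverse x) * inverse x ^ k) has_real_derivative
        exp (- y) * (y * y) * y ^ k + exp (- y) * (- real k * y ^ (k + 1))) (at x)"
      by (simp only:)
    then show ?thesis
      using greater by (simp add: flat_def y_def divide_inverse power_inverse mult_ac)
  qed
  then show ?thesis
    by (rule has_field_derivative_transform_within_open[of _ _ _ "{0<..}"])
      (use greater in \<open>auto simp: flat_def\<close>)
qed

lemma times_differentiable_flat: "times_differentiable n (flat k)"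
proof (induction n arbitrary: k)
  case (Suc n)
  have "times_differentiable n (\<lambda>x. flat (k + 2) x + (- real k) * flat (k + 1) x)"
    by (intro times_differentiable_add times_differentiable_mult times_differentiable_const Suc)
  then show ?case by (rule times_differentiable_SucI[OF flat_deriv])
qed simp

section \<open>Piecewise constant functions\<close>

lemma piecewise_constant_half_lineD:
  assumes "piecewise_constant_half_line f" "is_interval I" "bounded I" "I \<subseteq> {0..}"
  shows "\<exists>P. finite P \<and> partition_on I P \<and> (\<forall>J\<in>P. is_interval J \<and> f constant_on J)"
  using assms by (simp add: piecewise_constant_half_line_def)

text \<open>Common refinement: intersections of pieces are again intervals. Empty intersections are
  discarded because a partition admits no empty part.\<close>

lemma piecewise_constant_half_line_combine:
  assumes "piecewise_constant_half_line f" "piecewise_constant_half_line g"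
  shows "piecewise_constant_half_line (\<lambda>x. c (f x) (g x))"
  unfolding piecewise_constant_half_line_def
proof (intro allI impI)
  fix I :: "real set" assume I: "is_interval I \<and> bounded I \<and> I \<subseteq> {0..}"
  obtain P where P: "finite P" "partition_on I P" "\<And>J. J \<in> P \<Longrightarrow> is_interval J \<and> f constant_on J"
    using piecewise_constant_half_lineD[OF assms(1), of I] I by metis
  obtain Q where Q: "finite Q" "partition_on I Q" "\<And>J. J \<in> Q \<Longrightarrow> is_interval J \<and> g constant_on J"
    using piecewise_constant_half_lineD[OF assms(2), of I] I by metis
  define S where "S = (\<lambda>(J, J'). J \<inter> J') ` (P \<times> Q) - {{}}"
  have "finite S" using P(1) Q(1) by (simp add: S_def)
  moreover have "partition_on I S"
  proof (rule partition_onI)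
    show "\<Union> S = I"
    proof -
      have "\<Union> S = \<Union> P \<inter> \<Union> Q" by (auto simp: S_def)
      then show ?thesis using P(2) Q(2) by (simp add: partition_on_def)
    qed
    show "{} \<notin> S" by (simp add: S_def)
    fix A B assume "A \<in> S" "B \<in> S" "A \<noteq> B"
    then obtain J1 J2 J3 J4 where J: "J1 \<in> P" "J3 \<in> P" "J2 \<in> Q" "J4 \<in> Q" "A = J1 \<inter> J2" "B = J3 \<inter> J4"
      by (auto simp: S_def)
    show "disjnt A B"
    proof (cases "J1 = J3")
      case True
      then have "J2 \<noteq> J4" using J \<open>A \<noteq> B\<close> by auto
      then have "J2 \<inter> J4 = {}" using J Q(2) by (auto simp: partition_on_def disjoint_def)
      then show ?thesis using J by (auto simp: disjnt_def)
    next
      case False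
      then have "J1 \<inter> J3 = {}" using J P(2) by (auto simp: partition_on_def disjoint_def)
      then show ?thesis using J by (auto simp: disjnt_def)
    qed
  qed
  moreover have "is_interval J \<and> (\<lambda>x. c (f x) (g x)) constant_on J" if J: "J \<in> S" for J
  proof -
    obtain J1 J2 where J12: "J1 \<in> P" "J2 \<in> Q" "J = J1 \<inter> J2" using J by (auto simp: S_def)
    have "is_interval J" using P(3) Q(3) J12 by (auto intro: is_interval_Int)
    moreover have "(\<lambda>x. c (f x) (g x)) constant_on J"
      using P(3)[OF J12(1)] Q(3)[OF J12(2)] J12(3) unfolding constant_on_def by (metis IntE)
    ultimately show ?thesis by blast
  qed
  ultimately show "\<exists>P. finite P \<and> partition_on I P \<and>
      (\<forall>J\<in>P. is_interval J \<and> (\<lambda>x. c (f x) (g x)) constant_on J)" by blast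
qed

lemma piecewise_constant_half_line_const: "piecewise_constant_half_line (\<lambda>x. c)"
  unfolding piecewise_constant_half_line_def
proof (intro allI impI)
  fix I :: "real set" assume "is_interval I \<and> bounded I \<and> I \<subseteq> {0..}"
  then show "\<exists>P. finite P \<and> partition_on I P \<and> (\<forall>J\<in>P. is_interval J \<and> (\<lambda>x. c) constant_on J)"
    by (intro exI[of _ "{I} - {{}}"]) (auto simp: partition_on_def disjoint_def constant_on_def)
qed

lemma piecewise_constant_half_line_sum:
  "finite A \<Longrightarrow> (\<And>i. i \<in> A \<Longrightarrow> piecewise_constant_half_line (f i)) \<Longrightarrow>
    piecewise_constant_half_line (\<lambda>x. \<Sum>i\<in>A. f i x)"
  by (induction A rule: finite_induct)
    (auto simp: piecewise_constant_half_line_const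
      intro!: piecewise_constant_half_line_combine[of _ _ "(+)"])

text \<open>Level sets of a monotone function are intervals, and on a bounded set only finitely many
  integers occur as values.\<close>

lemma piecewise_constant_half_line_floor:
  assumes "T > 0"
  shows "piecewise_constant_half_line (\<lambda>x. real_of_int \<lfloor>(x - a) / T\<rfloor>)"
  unfolding piecewise_constant_half_line_def
proof (intro allI impI)
  fix I :: "real set" assume I: "is_interval I \<and> bounded I \<and> I \<subseteq> {0..}"
  define z where "z x = \<lfloor>(x - a) / T\<rfloor>" for x
  have mono: "z x \<le> z y" if "x \<le> y" for x y
    unfolding z_def using assms that by (intro floor_mono divide_right_mono) auto
  obtain B where B: "\<And>x. x \<in> I \<Longrightarrow> \<bar>x\<bar> \<le> B" using I unfolding bounded_iff by auto
  define P where "P = (\<lambda>i. {x \<in> I. z x = i}) ` (z ` I)"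
  have "z ` I \<subseteq> {z (- B)..z B}" using B by (auto intro!: mono simp: abs_le_iff) (smt (verit) B)+
  then have "finite P" unfolding P_def using finite_subset by blast
  moreover have "partition_on I P"
    by (rule partition_onI) (auto simp: P_def disjnt_def)
  moreover have "is_interval J \<and> (\<lambda>x. real_of_int (z x)) constant_on J" if "J \<in> P" for J
  proof -
    obtain i where J: "J = {x \<in> I. z x = i}" using \<open>J \<in> P\<close> by (auto simp: P_def)
    have "is_interval J"
      unfolding is_interval_1
    proof (intro ballI allI impI)
      fix x y w assume "x \<in> J" "y \<in> J" "x \<le> w \<and> w \<le> y"
      then show "w \<in> J"
        using I mono[of x w] mono[of w y] unfolding J is_interval_1 by auto
    qed
    then show ?thesis by (auto simp: J constant_on_def)
  qed
  ultimately show "\<exists>P. finite P \<and> partition_on I P \<and>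
      (\<forall>J\<in>P. is_interval J \<and> (\<lambda>x. real_of_int \<lfloor>(x - a) / T\<rfloor>) constant_on J)"
    unfolding z_def by blast
qed

section \<open>Periodic pulse trains\<close>

text \<open>Time is measured in periods, so \<open>r\<close> stands for \<open>h / t0\<close>.
  Between \<open>r / 3\<close> and \<open>r\<close> only the sign is prescribed, so that smooth and
  step profiles both qualify.\<close>

definition pulse_profile :: "real \<Rightarrow> (real \<Rightarrow> real) \<Rightarrow> bool" where
  "pulse_profile r \<beta> \<longleftrightarrow> (\<forall>x. \<beta> x \<ge> 0) \<and> (\<forall>x. \<beta> (x + 1) = \<beta> x) \<and>
     (\<forall>x. \<bar>x\<bar> \<le> r / 3 \<longrightarrow> \<beta> x \<ge> 1) \<and> (\<forall>x. r \<le> x \<and> x \<le> 1 - r \<longrightarrow> \<beta> x = 0)"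

definition pulse_time :: "(nat \<Rightarrow> real) \<Rightarrow> nat \<Rightarrow> real" where
  "pulse_time lam k = pi / 2 * (\<Sum>j=1..k. 1 / lam j)"

text \<open>The pulses \<open>j = 0\<close> and \<open>j = n\<close> coincide modulo the period; keeping both makes every slot look alike.\<close>

definition pulse_train ::
  "nat \<Rightarrow> (nat \<Rightarrow> real) \<Rightarrow> real \<Rightarrow> real \<Rightarrow> (real \<Rightarrow> real) \<Rightarrow> real \<Rightarrow> real" where
  "pulse_train n lam K t0 \<beta> t = K * (\<Sum>j=0..n. \<beta> ((t - pulse_time lam j) / t0))"

lemma pulse_profile_shift:
  assumes "pulse_profile r \<beta>"
  shows "\<beta> (x + real m) = \<beta> x"
proof (induction m)
  case (Suc m)
  have "\<beta> (x + real (Suc m)) = \<beta> (x + real m + 1)" by (simp add: add_ac)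
  also have "\<dots> = \<beta> x" using assms Suc by (simp add: pulse_profile_def)
  finally show ?case .
qed simp

lemma pulse_time_mono:
  assumes "\<And>k. k \<in> {1..n} \<Longrightarrow> lam k > 0" "i \<le> j" "j \<le> n"
  shows "pulse_time lam i \<le> pulse_time lam j"
  unfolding pulse_time_def using assms
  by (intro mult_left_mono sum_mono2) (auto simp: less_imp_le)

lemma pulse_train_shift:
  assumes "pulse_profile r \<beta>" "t0 > 0"
  shows "pulse_train n lam K t0 \<beta> (t + real m * t0) = pulse_train n lam K t0 \<beta> t"
proof -
  have "(t + real m * t0 - c) / t0 = (t - c) / t0 + real m" for c
    using assms(2) by (simp add: field_simps)
  then show ?thesis by (simp add: pulse_train_def pulse_profile_shift[OF assms(1)])
qed

lemma pulse_train_ge: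
  assumes \<beta>: "pulse_profile r \<beta>" and "t0 > 0" "K > 0" "j \<le> n"
    and "\<bar>t - pulse_time lam j\<bar> \<le> r * t0 / 3"
  shows "pulse_train n lam K t0 \<beta> t \<ge> K"
proof -
  have "\<bar>(t - pulse_time lam j) / t0\<bar> \<le> r / 3" using assms by (simp add: field_simps)
  then have "1 \<le> \<beta> ((t - pulse_time lam j) / t0)" using \<beta> by (simp add: pulse_profile_def)
  also have "\<dots> \<le> (\<Sum>j=0..n. \<beta> ((t - pulse_time lam j) / t0))"
    by (rule member_le_sum) (use assms \<beta> in \<open>auto simp: pulse_profile_def\<close>)
  finally show ?thesis using \<open>K > 0\<close> by (simp add: pulse_train_def)
qed

text \<open>The slot lies within one period. A pulse behind it has phase in
  \<open>{r..1 - r}\<close> at time \<open>t\<close>; a pulse ahead of it does so after adding 1 to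
  the phase.\<close>

lemma pulse_train_eq_0:
  assumes \<beta>: "pulse_profile r \<beta>" and "t0 > 0" and lam: "\<And>k. k \<in> {1..n} \<Longrightarrow> lam k > 0"
    and t0: "t0 = pulse_time lam n" and "Suc k \<le> n" and "r > 0"
    and t: "pulse_time lam k + r * t0 \<le> t" "t \<le> pulse_time lam (Suc k) - r * t0"
  shows "pulse_train n lam K t0 \<beta> t = 0"
proof -
  have s0: "pulse_time lam 0 = 0" by (simp add: pulse_time_def)
  have mono: "pulse_time lam i \<le> pulse_time lam j" if "i \<le> j" "j \<le> n" for i j
    using pulse_time_mono[of n lam i j] lam that by blast
  have "\<beta> ((t - pulse_time lam j) / t0) = 0" if "j \<le> n" for j
  proof -
    have s: "0 \<le> pulse_time lam k" "pulse_time lam (Suc k) \<le> t0"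
      "0 \<le> pulse_time lam j" "pulse_time lam j \<le> t0"
      using mono[of 0 k] mono[of "Suc k" n] mono[of 0 j] mono[of j n] assms that s0 by auto
    show ?thesis
    proof (cases "j \<le> k")
      case True
      have "pulse_time lam j \<le> pulse_time lam k" using mono[OF True] assms by simp
      then have "r * t0 \<le> t - pulse_time lam j" "t - pulse_time lam j \<le> t0 - r * t0"
        using s t by auto
      then have "r \<le> (t - pulse_time lam j) / t0" "(t - pulse_time lam j) / t0 \<le> 1 - r"
        using \<open>t0 > 0\<close> by (auto simp: field_simps)
      then show ?thesis using \<beta> by (simp add: pulse_profile_def)
    next
      case False
      have "pulse_time lam (Suc k) \<le> pulse_time lam j"
        using mono[of "Suc k" j] False that by simp
      then have "r * t0 \<le> t - pulse_time lam j + t0" "t - pulse_time lam j + t0 \<le> t0 - r * t0"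
        using s t by auto
      then have "r \<le> (t - pulse_time lam j) / t0 + 1" "(t - pulse_time lam j) / t0 + 1 \<le> 1 - r"
        using \<open>t0 > 0\<close> by (auto simp: field_simps)
      then have "\<beta> ((t - pulse_time lam j) / t0 + 1) = 0" using \<beta> unfolding pulse_profile_def by blast
      then show ?thesis using \<beta> by (simp add: pulse_profile_def)
    qed
  qed
  then show ?thesis by (simp add: pulse_train_def)
qed

lemma admissible_pulse_train:
  assumes lam: "\<And>k. k \<in> {1..n} \<Longrightarrow> lam k > 0" and "R > 0"
    and t0: "t0 = pulse_time lam n" and "t0 > 0"
    and "h > 0" and h: "\<And>k. k \<in> {1..n} \<Longrightarrow> 2 * h \<le> pi / (2 * lam k)"
    and "K > 0" and fac: "\<And>k. k \<in> {1..n} \<Longrightarrow> slot_factor (lam k) K h \<le> exp (- R * t0)"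
    and \<beta>: "pulse_profile (h / t0) \<beta>"
  shows "admissible_damping n lam R t0 (pulse_train n lam K t0 \<beta>)"
proof -
  define \<delta> where "\<delta> = pulse_train n lam K t0 \<beta>"
  have nonneg: "\<delta> t \<ge> 0" for t
    using \<beta> \<open>K > 0\<close> unfolding \<delta>_def pulse_train_def
    by (intro mult_nonneg_nonneg sum_nonneg) (auto simp: pulse_profile_def)
  have shift: "\<delta> (t + real m * t0) = \<delta> t" for t m
    unfolding \<delta>_def by (rule pulse_train_shift[OF \<beta> \<open>t0 > 0\<close>])
  have "energy n lam u t \<le> energy n lam u 0 * exp (- R * max (t - t0) 0)"
    if sol: "damped_system_solution n lam \<delta> u" and "t \<ge> 0" for u t
  proof -
    define e where "e k t = (half_line_deriv (u k) t)\<^sup>2 + (lam k)\<^sup>2 * (u k t)\<^sup>2" for k t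
    have energy: "energy n lam u t = (\<Sum>k=1..n. e k t)" for t by (simp add: energy_def e_def)
    have osc: "\<exists>N. damped_oscillator \<delta> (u k) (half_line_deriv (u k)) (lam k) N" if "k \<in> {1..n}" for k
      using damped_solution_oscillator[of \<delta> "lam k" "u k"] sol that lam nonneg
      by (simp add: damped_system_solution_def)
    have mono: "e k b \<le> e k a" if "k \<in> {1..n}" "0 \<le> a" "a \<le> b" for k a b
    proof -
      obtain N where "damped_oscillator \<delta> (u k) (half_line_deriv (u k)) (lam k) N"
        using osc[OF \<open>k \<in> {1..n}\<close>] by blast
      then interpret damped_oscillator \<delta> "u k" "half_line_deriv (u k)" "lam k" N .
      show ?thesis using energy_antimono[OF \<open>0 \<le> a\<close> \<open>a \<le> b\<close>] by (simp add: E_def e_def)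
    qed
    have period: "e k (real (Suc m) * t0) \<le> exp (- R * t0) * e k (real m * t0)"
      if k: "k \<in> {1..n}" for k m
    proof -
      obtain N where "damped_oscillator \<delta> (u k) (half_line_deriv (u k)) (lam k) N"
        using osc[OF k] by blast
      then interpret damped_oscillator \<delta> "u k" "half_line_deriv (u k)" "lam k" N .
      have Ee: "E = e k" by (simp add: E_def e_def fun_eq_iff)
      \<comment> \<open>Component \<open>k\<close> is served by the slot from pulse
        \<open>k - 1\<close> to pulse \<open>k\<close>; outside it only monotonicity of its energy
        is used.\<close>
      obtain i where i: "k = Suc i" using k by (cases k) auto
      define L where "L = pi / (2 * lam k)"
      define s where "s = pulse_time lam i"
      have sL: "pulse_time lam k = s + L"
        by (simp add: pulse_time_def s_def L_def i algebra_simps)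
      have s: "0 \<le> s" "s + L \<le> t0"
        using pulse_time_mono[of n lam 0 i] pulse_time_mono[of n lam k n] lam k i sL
          pulse_time_def[of lam 0]
        by (auto simp: t0 s_def)
      \<comment> \<open>Periodicity moves every slot back to the first period, where the pulse train
        is analysed.\<close>
      have \<delta>_shift: "\<delta> t = \<delta> (t - real m * t0)" for t
        using shift[of "t - real m * t0" m] by simp
      have ht: "h / t0 * t0 = h" using \<open>t0 > 0\<close> by simp
      have "E (real m * t0 + s + L) \<le> slot_factor (lam k) K h * E (real m * t0 + s)"
      proof (rule slot_decay[OF _ \<open>h > 0\<close> h[OF k] \<open>K > 0\<close> L_def])
        show "0 \<le> real m * t0 + s" using s \<open>t0 > 0\<close> by simp
        show "K \<le> \<delta> t" if "t \<in> {real m * t0 + s..real m * t0 + s + h / 3}" for t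
          unfolding \<delta>_shift[of t] unfolding \<delta>_def
          by (rule pulse_train_ge[OF \<beta> \<open>t0 > 0\<close> \<open>K > 0\<close>, of i])
            (use that k i ht in \<open>auto simp: s_def\<close>)
        show "K \<le> \<delta> t" if "t \<in> {real m * t0 + s + L - h / 3..real m * t0 + s + L}" for t
          unfolding \<delta>_shift[of t] unfolding \<delta>_def
          by (rule pulse_train_ge[OF \<beta> \<open>t0 > 0\<close> \<open>K > 0\<close>, of k])
            (use that k ht sL in auto)
        show "\<delta> t = 0" if "t \<in> {real m * t0 + s + h..real m * t0 + s + L - h}" for t
          unfolding \<delta>_shift[of t] unfolding \<delta>_def
          by (rule pulse_train_eq_0[where k = i and lam = lam, OF \<beta> \<open>t0 > 0\<close> lam t0])
            (use that k ht sL s_def i \<open>h > 0\<close> \<open>t0 > 0\<close> in auto)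
      qed
      also have "\<dots> \<le> exp (- R * t0) * E (real m * t0)"
        using fac[OF k] E_nonneg s \<open>t0 > 0\<close> by (intro mult_mono energy_antimono) auto
      finally have "E (real m * t0 + s + L) \<le> exp (- R * t0) * E (real m * t0)" .
      moreover have "E (real (Suc m) * t0) \<le> E (real m * t0 + s + L)"
        using s l_pos \<open>t0 > 0\<close> by (intro energy_antimono) (auto simp: L_def algebra_simps)
      ultimately show ?thesis by (simp add: Ee)
    qed
    have iter: "energy n lam u (real m * t0) \<le> exp (- R * (real m * t0)) * energy n lam u 0" for m
    proof (induction m)
      case (Suc m)
      have "energy n lam u (real (Suc m) * t0) \<le> exp (- R * t0) * energy n lam u (real m * t0)"
        unfolding energy sum_distrib_left by (intro sum_mono period)
      also have "\<dots> \<le> exp (- R * t0) * (exp (- R * (real m * t0)) * energy n lam u 0)"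
        using Suc by (intro mult_left_mono) auto
      also have "\<dots> = exp (- R * (real (Suc m) * t0)) * energy n lam u 0"
      proof -
        have "- R * (real (Suc m) * t0) = - R * t0 + - R * (real m * t0)" by (simp add: algebra_simps)
        then show ?thesis by (simp only: exp_add mult.assoc)
      qed
      finally show ?case .
    qed simp
    \<comment> \<open>Number of complete periods. The incomplete one yields no decay, and it is
      shorter than \<open>t0\<close>, which is exactly the delay granted in the exponent.\<close>
    define m where "m = nat \<lfloor>t / t0\<rfloor>"
    have "real m = real_of_int \<lfloor>t / t0\<rfloor>" using \<open>t \<ge> 0\<close> \<open>t0 > 0\<close> by (simp add: m_def)
    then have "real m \<le> t / t0" "t / t0 \<le> real m + 1" by linarith+
    then have m: "real m * t0 \<le> t" "t - t0 \<le> real m * t0"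
      using \<open>t0 > 0\<close> by (auto simp: field_simps)
    have "0 \<le> energy n lam u 0" by (simp add: energy_def sum_nonneg)
    have "energy n lam u t \<le> energy n lam u (real m * t0)"
      unfolding energy using m \<open>t0 > 0\<close> by (intro sum_mono mono) auto
    also have "\<dots> \<le> exp (- R * (real m * t0)) * energy n lam u 0" by (rule iter)
    also have "\<dots> \<le> exp (- R * max (t - t0) 0) * energy n lam u 0"
      using m \<open>t0 > 0\<close> \<open>R > 0\<close> \<open>0 \<le> energy n lam u 0\<close> by (intro mult_right_mono) auto
    finally show ?thesis by (simp add: mult.commute)
  qed
  then show ?thesis
    unfolding admissible_damping_def \<delta>_def[symmetric] using nonneg shift[of _ 1] by simp
qed

section \<open>Calibration of the pulses and the two profiles\<close>

lemma eventually_slot_factor_le: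
  assumes "l > 0" "c > 0"
  shows "\<forall>\<^sub>F h in at_right 0. slot_factor l (1 / h\<^sup>2) h \<le> c"
proof -
  have "((\<lambda>h. pulse_defect l (1 / h\<^sup>2) h) \<longlongrightarrow> 0) (at_right 0)"
  proof (rule tendsto_sandwich)
    have pos: "\<forall>\<^sub>F h in at_right 0. 0 < (h::real)" by (rule eventually_at_right_less)
    then show "\<forall>\<^sub>F h in at_right 0. 0 \<le> pulse_defect l (1 / h\<^sup>2) h"
      by eventually_elim (use \<open>l > 0\<close> in \<open>simp add: pulse_defect_def\<close>)
    show "\<forall>\<^sub>F h in at_right 0. pulse_defect l (1 / h\<^sup>2) h \<le> h + l * h\<^sup>2 / 4 + l * h"
      using pos
    proof eventually_elim
      case (elim h)
      \<comment> \<open>With \<open>K = 1 / h\<^sup>2\<close> the exponent in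
        \<open>pulse_defect\<close> is \<open>- x\<close>. As \<open>x\<close> exceeds
        \<open>1 / h\<close>, the bound \<open>exp x \<ge> 1 + x\<close> already gives
        \<open>exp (- x) \<le> h\<close>.\<close>
      define x where "x = 4 / (3 * h)"
      have "1 / h \<le> x" "0 < x" using elim by (auto simp: x_def field_simps)
      then have "1 / h \<le> exp x" using exp_ge_add_one_self[of x] by linarith
      then have "exp (- x) \<le> h" using elim by (simp add: exp_minus field_simps)
      moreover have "- 4 * (1 / h\<^sup>2) * (h / 3) = - x" using elim by (simp add: x_def power2_eq_square)
      ultimately show ?case by (simp add: pulse_defect_def)
    qed
    have "((\<lambda>h. h + l * h\<^sup>2 / 4 + l * h) \<longlongrightarrow> 0 + l * 0\<^sup>2 / 4 + l * 0) (at_right 0)"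
      by (intro tendsto_intros) auto
    then show "((\<lambda>h. h + l * h\<^sup>2 / 4 + l * h) \<longlongrightarrow> 0) (at_right 0)" by simp
  qed simp
  then have "((\<lambda>h. slot_factor l (1 / h\<^sup>2) h) \<longlongrightarrow> 0 + (3 * l * 0 + sqrt 0)\<^sup>2) (at_right 0)"
    unfolding slot_factor_def by (intro tendsto_intros)
  then have "((\<lambda>h. slot_factor l (1 / h\<^sup>2) h) \<longlongrightarrow> 0) (at_right 0)" by simp
  from order_tendstoD(2)[OF this \<open>c > 0\<close>] show ?thesis
    by (rule eventually_mono) simp
qed

text \<open>The difference counts the integers \<open>m\<close> with
  \<open>m - r / 2 \<le> x < m + r / 2\<close>, so it is the indicator of the integer translates of
  a half-open interval. Its half-width \<open>r / 2\<close> lies between \<open>r / 3\<close> and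
  \<open>r\<close>.\<close>

lemma pulse_profile_floor:
  assumes "0 < r" "r < 1 / 2"
  shows "pulse_profile r (\<lambda>x. real_of_int \<lfloor>x + r / 2\<rfloor> - real_of_int \<lfloor>x - r / 2\<rfloor>)"
  unfolding pulse_profile_def
proof (intro conjI allI impI)
  fix x :: real
  show "0 \<le> real_of_int \<lfloor>x + r / 2\<rfloor> - real_of_int \<lfloor>x - r / 2\<rfloor>"
    using floor_mono[of "x - r / 2" "x + r / 2"] assms by simp
  show "real_of_int \<lfloor>x + 1 + r / 2\<rfloor> - real_of_int \<lfloor>x + 1 - r / 2\<rfloor> =
      real_of_int \<lfloor>x + r / 2\<rfloor> - real_of_int \<lfloor>x - r / 2\<rfloor>"
    using floor_add_int[of "x + r / 2" 1] floor_add_int[of "x - r / 2" 1] by (simp add: algebra_simps)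
  show "1 \<le> real_of_int \<lfloor>x + r / 2\<rfloor> - real_of_int \<lfloor>x - r / 2\<rfloor>" if "\<bar>x\<bar> \<le> r / 3"
  proof -
    have "\<lfloor>x + r / 2\<rfloor> = 0" "\<lfloor>x - r / 2\<rfloor> = - 1" using that assms by (auto simp: floor_eq_iff)
    then show ?thesis by simp
  qed
  show "real_of_int \<lfloor>x + r / 2\<rfloor> - real_of_int \<lfloor>x - r / 2\<rfloor> = 0" if "r \<le> x \<and> x \<le> 1 - r"
  proof -
    have "\<lfloor>x + r / 2\<rfloor> = 0" "\<lfloor>x - r / 2\<rfloor> = 0" using that assms by (auto simp: floor_eq_iff)
    then show ?thesis by simp
  qed
qed

text \<open>
  Both \<open>flat 0\<close> and \<open>sin\<^sup>2\<close> are smooth, and \<open>sin\<^sup>2 (\<pi> x)\<close> has period 1 and vanishes exactly at the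
  integers, so no periodic extension of a bump function is needed.
\<close>

definition smooth_pulse :: "real \<Rightarrow> real \<Rightarrow> real" where
  "smooth_pulse r x = flat 0 ((sin (pi * r))\<^sup>2 - (sin (pi * x))\<^sup>2) /
     flat 0 ((sin (pi * r))\<^sup>2 - (sin (pi * (r / 3)))\<^sup>2)"

lemma flat_0_mono: "x \<le> y \<Longrightarrow> flat 0 x \<le> flat 0 y"
  by (simp add: flat_def divide_simps)

text \<open>As \<open>sin\<^sup>2 (pi * x)\<close> increases on \<open>{0..1 / 2}\<close>, the
  argument of \<open>flat 0\<close> becomes nonpositive from \<open>r\<close> on, while up to
  \<open>r / 3\<close> it is at least its value at \<open>r / 3\<close>. Dividing by
  \<open>flat 0\<close> at that value makes the plateau at least 1.\<close>

lemma pulse_profile_smooth_pulse: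
  assumes r: "0 < r" "r < 1 / 2"
  shows "pulse_profile r (smooth_pulse r)"
proof -
  have pr: "0 < pi * r" "pi * r < pi / 2" "pi * (r / 3) < pi * r" "0 < pi * (r / 3)" using r by auto
  have sin_lt: "sin (pi * (r / 3)) < sin (pi * r)"
    by (rule sin_monotone_2pi) (use pr in linarith)+
  have "0 \<le> sin (pi * (r / 3))" by (rule sin_ge_zero) (use pr in linarith)+
  then have "(sin (pi * (r / 3)))\<^sup>2 < (sin (pi * r))\<^sup>2"
    using sin_lt by (intro power_strict_mono) auto
  then have pos: "flat 0 ((sin (pi * r))\<^sup>2 - (sin (pi * (r / 3)))\<^sup>2) > 0"
    by (simp add: flat_def)
  show ?thesis
    unfolding pulse_profile_def
  proof (intro conjI allI impI)
    fix x :: real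
    show "0 \<le> smooth_pulse r x" by (simp add: smooth_pulse_def flat_nonneg)
    have "sin (pi * (x + 1)) = - sin (pi * x)" by (simp add: distrib_left)
    then show "smooth_pulse r (x + 1) = smooth_pulse r x" by (simp add: smooth_pulse_def)
    show "1 \<le> smooth_pulse r x" if x: "\<bar>x\<bar> \<le> r / 3"
    proof -
      have px: "0 \<le> pi * \<bar>x\<bar>" "pi * \<bar>x\<bar> \<le> pi * (r / 3)" using x by (auto intro!: mult_left_mono)
      have "sin (pi * \<bar>x\<bar>) \<le> sin (pi * (r / 3))"
        by (rule sin_monotone_2pi_le) (use pr px in linarith)+
      moreover have "0 \<le> sin (pi * \<bar>x\<bar>)" by (rule sin_ge_zero) (use pr px in linarith)+
      ultimately have "(sin (pi * \<bar>x\<bar>))\<^sup>2 \<le> (sin (pi * (r / 3)))\<^sup>2" by (intro power_mono)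
      moreover have "(sin (pi * \<bar>x\<bar>))\<^sup>2 = (sin (pi * x))\<^sup>2" by (cases "x \<ge> 0") auto
      ultimately show ?thesis using pos by (simp add: smooth_pulse_def flat_0_mono)
    qed
    show "smooth_pulse r x = 0" if x: "r \<le> x \<and> x \<le> 1 - r"
    proof -
      \<comment> \<open>Reflection at \<open>1 / 2\<close> preserves the sine and leads back to the
        range where it increases.\<close>
      define y where "y = (if x \<le> 1 / 2 then x else 1 - x)"
      have y: "r \<le> y" "y \<le> 1 / 2" using x by (auto simp: y_def)
      have py: "pi * r \<le> pi * y" "pi * y \<le> pi * (1 / 2)" by (intro mult_left_mono; use y in simp)+
      have "sin (pi * x) = sin (pi * y)" by (simp add: y_def right_diff_distrib)
      moreover have "sin (pi * r) \<le> sin (pi * y)"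
        by (rule sin_monotone_2pi_le) (use pr py in linarith)+
      moreover have "0 \<le> sin (pi * r)" by (rule sin_ge_zero) (use pr in linarith)+
      ultimately have "(sin (pi * r))\<^sup>2 \<le> (sin (pi * x))\<^sup>2" by (simp add: power_mono)
      then show ?thesis by (simp add: smooth_pulse_def flat_def)
    qed
  qed
qed

lemma smooth_pulse_train: "smooth_half_line (pulse_train n lam K t0 (smooth_pulse r))"
proof (rule times_differentiable_imp_smooth_half_line)
  fix m
  have sin: "times_differentiable m (\<lambda>t. sin (pi * ((t - c) / t0)))" for c
  proof -
    have "(\<lambda>t. sin (pi * ((t - c) / t0))) = (\<lambda>t. sin ((pi / t0 * t + (- pi * c / t0)) + 0))"
      by (simp add: diff_divide_distrib algebra_simps)
    then show ?thesis
      using times_differentiable_compose[OF times_differentiable_sin[of m 0]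
          times_differentiable_affine[of m "pi / t0" "- pi * c / t0"]] by simp
  qed
  \<comment> \<open>The square and the difference are rewritten as a product and a sum, the shapes
    for which closure rules are available.\<close>
  have eq: "pulse_train n lam K t0 (smooth_pulse r) = (\<lambda>t. K * (\<Sum>j=0..n.
      flat 0 ((sin (pi * r))\<^sup>2 + (- 1) * (sin (pi * ((t - pulse_time lam j) / t0)) *
        sin (pi * ((t - pulse_time lam j) / t0)))) *
      inverse (flat 0 ((sin (pi * r))\<^sup>2 - (sin (pi * (r / 3)))\<^sup>2))))"
    by (rule ext) (simp only: pulse_train_def smooth_pulse_def power2_eq_square divide_inverse
      mult_minus1 diff_conv_add_uminus)
  show "times_differentiable m (pulse_train n lam K t0 (smooth_pulse r))"
    unfolding eq
    by (intro times_differentiable_mult times_differentiable_sum times_differentiable_const sin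
      times_differentiable_compose[OF times_differentiable_flat] times_differentiable_add) auto
qed

lemma piecewise_constant_pulse_train:
  assumes "t0 > 0"
  shows "piecewise_constant_half_line
    (pulse_train n lam K t0 (\<lambda>x. real_of_int \<lfloor>x + r / 2\<rfloor> - real_of_int \<lfloor>x - r / 2\<rfloor>))"
proof -
  have shift: "(t - c) / t0 + d = (t - (c - d * t0)) / t0" for t c d
    using assms by (simp add: field_simps)
  have floor: "piecewise_constant_half_line (\<lambda>t. real_of_int \<lfloor>(t - c) / t0 + d\<rfloor>)" for c d
    unfolding shift by (rule piecewise_constant_half_line_floor[OF assms])
  have "piecewise_constant_half_line (\<lambda>t. real_of_int \<lfloor>(t - c) / t0 + r / 2\<rfloor> -
      real_of_int \<lfloor>(t - c) / t0 - r / 2\<rfloor>)" for c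
    using piecewise_constant_half_line_combine[OF floor[of c "r / 2"] floor[of c "- (r / 2)"], of "(-)"]
    by simp
  then show ?thesis
    unfolding pulse_train_def[abs_def]
    by (intro piecewise_constant_half_line_combine[OF piecewise_constant_half_line_const, of _ "(*)"]
        piecewise_constant_half_line_sum) auto
qed

theorem theorem2p3:
  fixes n :: nat and lam :: "nat \<Rightarrow> real" and R t0 :: real
  assumes "n \<ge> 1"
    and "\<And>k. k \<in> {1..n} \<Longrightarrow> lam k > 0"
    and "R > 0"
    and "t0 = pi / 2 * (\<Sum>k=1..n. 1 / lam k)"
  shows "(\<exists>\<delta>. admissible_damping n lam R t0 \<delta>) \<and>
    (\<exists>\<delta>. admissible_damping n lam R t0 \<delta> \<and> smooth_half_line \<delta>) \<and>
    (\<exists>\<delta>. admissible_damping n lam R t0 \<delta> \<and> piecewise_constant_half_line \<delta>)"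
proof -
  have t0: "t0 = pulse_time lam n" using assms(4) by (simp add: pulse_time_def)
  have "t0 > 0"
    unfolding assms(4) using assms(1,2) by (intro mult_pos_pos sum_pos) auto
  \<comment> \<open>There are finitely many components, so one small \<open>h\<close> serves them
    all. The further bounds keep two pulses from filling more than a slot and make
    \<open>h / t0\<close> smaller than \<open>1 / 2\<close>.\<close>
  have "\<forall>\<^sub>F h in at_right 0. \<forall>k\<in>{1..n}. slot_factor (lam k) (1 / h\<^sup>2) h \<le> exp (- R * t0)"
    using assms(2) by (intro eventually_ball_finite ballI eventually_slot_factor_le) auto
  moreover have "\<forall>\<^sub>F h in at_right 0. \<forall>k\<in>{1..n}. h < pi / (4 * lam k)"
    using assms(2) by (intro eventually_ball_finite ballI order_tendstoD(2)[OF tendsto_ident_at]) auto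
  moreover have "\<forall>\<^sub>F h in at_right 0. h < t0 / 2"
    using \<open>t0 > 0\<close> by (intro order_tendstoD(2)[OF tendsto_ident_at]) auto
  moreover have "\<forall>\<^sub>F h in at_right 0. 0 < (h::real)" by (rule eventually_at_right_less)
  ultimately have "\<forall>\<^sub>F h in at_right 0. (\<forall>k\<in>{1..n}. slot_factor (lam k) (1 / h\<^sup>2) h \<le> exp (- R * t0)) \<and>
      (\<forall>k\<in>{1..n}. h < pi / (4 * lam k)) \<and> h < t0 / 2 \<and> 0 < h"
    by eventually_elim blast
  then obtain h where "\<forall>k\<in>{1..n}. slot_factor (lam k) (1 / h\<^sup>2) h \<le> exp (- R * t0)"
    and h: "\<forall>k\<in>{1..n}. h < pi / (4 * lam k)" "h < t0 / 2" "0 < h"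
    using eventually_happens'[OF trivial_limit_at_right_real] by blast
  \<comment> \<open>The profile stays arbitrary, so the same \<open>h\<close> and \<open>K\<close>
    serve the smooth and the piecewise constant damping.\<close>
  have adm: "admissible_damping n lam R t0 (pulse_train n lam (1 / h\<^sup>2) t0 \<beta>)"
    if "pulse_profile (h / t0) \<beta>" for \<beta>
  proof (rule admissible_pulse_train[OF assms(2,3) t0 \<open>t0 > 0\<close> \<open>0 < h\<close> _ _ _ that])
    show "2 * h \<le> pi / (2 * lam k)" if "k \<in> {1..n}" for k
      using bspec[OF h(1) that] by simp
  qed (use \<open>\<forall>k\<in>{1..n}. slot_factor _ _ h \<le> _\<close> \<open>0 < h\<close> in auto)
  have r: "0 < h / t0" "h / t0 < 1 / 2" using h \<open>t0 > 0\<close> by (auto simp: field_simps)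
  show ?thesis
    using adm[OF pulse_profile_smooth_pulse[OF r]] smooth_pulse_train
      adm[OF pulse_profile_floor[OF r]] piecewise_constant_pulse_train[OF \<open>t0 > 0\<close>]
    by blast
qed

end
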